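(* Let $\Omega\subset\mathbb{R}^2$ be a domain with smooth (infinitely differentiable) compact boundary, and let $h:\partial\Omega\to(0,\infty)$ be a smooth function such that for each $\mathbf{y}\in\partial\Omega$ the segment $\{\mathbf{y}+t\hat{\mathbf{n}}(\mathbf{y}):t\in[0,h(\mathbf{y})]\}$ meets $\partial\Omega$ only at $\mathbf{y}$. Put $\mathbf{y}'=\mathbf{y}+h(\mathbf{y})\hat{\mathbf{n}}(\mathbf{y})$. Then the integral operator in the equation $$\rho_i(\mathbf{x})+\int_{\partial\Omega}\Sigma^{B,2}_{ik}(\mathbf{x},\mathbf{y};h(\mathbf{y}))\rho_k(\mathbf{y})\,dS(\mathbf{y})=f_i(\mathbf{x})$$ is independent of $\alpha$, and the equation can be written explicitly as $$\frac12\rho_i(\mathbf{x})-\frac1\pi\int_{\partial\Omega}\hat{\mathbf{n}}_j(\mathbf{x})\frac{(x_i-y_i)(x_j-y_j)(x_k-y_k)}{|\mathbf{x}-\mathbf{y}|^4}\rho_k(\mathbf{y})\,dS(\mathbf{y})=\frac12f_i(\mathbf{x})-\frac1\pi\int_{\partial\Omega}\hat{\mathbf{n}}_j(\mathbf{x})\frac{(x_i-y'_i)(x_j-y'_j)(x_k-y'_k)}{|\mathbf{x}-\mathbf{y}'|^4}\rho_k(\mathbf{y})\,dS(\mathbf{y}),$$ where the integral operator on the right-hand side has a smooth kernel on $\partial\Omega\times\partial\Omega$ and so is compact on $L^2(\partial\Omega;\mathbb{R}^2)$. In particular, if the equation is solvable for one value of $\alpha$, then it is solvable for every value of $\alpha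$.
   Context: Einstein summation is used. $\Omega$ may be bounded or unbounded; $\hat{\mathbf{n}}$ is the unit normal on $\partial\Omega$ pointing out of $\Omega$. The Lamé parameters $\lambda,\mu$ have $\mu>0$ and $\alpha=\frac{\lambda+\mu}{\lambda+2\mu}\in(1/4,1)$. The right-hand side $f$ and the density $\rho$ are in $L^2(\partial\Omega;\mathbb{R}^2)$ (solvability may be understood in any fixed subspaces chosen to handle the non-uniqueness due to rigid motions). Stress of a vector field $u$: $\sigma_{ij}[u]=\lambda\delta_{ij}\frac{\partial u_k}{\partial x_k}+\mu\left(\frac{\partial u_j}{\partial x_i}+\frac{\partial u_i}{\partial x_j}\right)$. For a matrix-valued $G(\mathbf{x})$, $\sigma$ acts columnwise in $\mathbf{x}$, and $\sigma[G]_{ijk}$ is the $(i,j)$ stress component of the $k$-th column. Let $\mathbf{r}=\mathbf{x}-\mathbf{y}$, $r=|\mathbf{r}|$, $\hat{\mathbf{v}}=(v_1,v_2)^T$ a unit vector, $\hat{\mathbf{v}}^\perp=(v_2,-v_1)$, and let $\arg(u,v)$ denote the argument of $v+iu$ with branch cut along the negative real axis. Define $$G^{B,2}(\mathbf{x},\mathbf{y};\hat{\mathbf{v}})=\frac{1}{2\pi\mu}\left[-\log(r)\,\mathrm{I}_2+\frac{\mathbf{r}\mathbf{r}^T}{r^2}\right]+\frac{1}{2\pi\mu}\frac{1-\alpha}{\alpha}\left[-\log(r)\,\mathrm{I}_2+\arg(\hat{\mathbf{v}}^\perp\cdot\mathbf{r},-\hat{\mathbf{v}}\cdot\mathbf{r})\begin{pmatrix}0&1\\-1&0\end{pmatrix}\right],$$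 $$K^{B,2}(\mathbf{x},\mathbf{y};\hat{\mathbf{v}},h)=-\int_0^h\hat{\mathbf{v}}\cdot\nabla_{\mathbf{y}}G^{B,2}(\mathbf{x},\mathbf{y}+t\hat{\mathbf{v}};\hat{\mathbf{v}})\,dt\qquad(h>0),$$ for $\mathbf{x}$ off the segment $\{\mathbf{y}+t\hat{\mathbf{v}}:t\in[0,h]\}$ (the derivative acts on the source variable with $\hat{\mathbf{v}}$ fixed, and removable singularities of the integrand are filled in by continuity). For $\mathbf{x}\neq\mathbf{y}$ in $\partial\Omega$, $\Sigma^{B,2}_{jk}(\mathbf{x},\mathbf{y};h)=\hat{\mathbf{n}}_i(\mathbf{x})\,\sigma[K^{B,2}(\cdot,\mathbf{y};\hat{\mathbf{n}}(\mathbf{y}),h)]_{ijk}(\mathbf{x})$. *)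

theory Defs
  imports "HOL-Analysis.Analysis"
begin

subsection \<open>Smooth functions\<close>

primrec times_cont_diff_on :: "nat \<Rightarrow> 'a::euclidean_space set \<Rightarrow> ('a \<Rightarrow> 'b::real_normed_vector) \<Rightarrow> bool"
  where
    "times_cont_diff_on 0 S f \<longleftrightarrow> continuous_on S f"
  | "times_cont_diff_on (Suc m) S f \<longleftrightarrow>
       (\<forall>x\<in>S. f differentiable (at x)) \<and>
       (\<forall>v. times_cont_diff_on m S (\<lambda>x. frechet_derivative f (at x) v))"

text \<open>Only meaningful on open sets.\<close>

definition smooth_on_open :: "'a::euclidean_space set \<Rightarrow> ('a \<Rightarrow> 'b::real_normed_vector) \<Rightarrow> bool"
  where "smooth_on_open U f \<longleftrightarrow> (\<forall>m. times_cont_diff_on m U f)"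

text \<open>Smoothness on an arbitrary subset of a Euclidean space, such as an embedded curve or a product
  of two curves: near each point the function has a smooth extension to the ambient space.\<close>

definition smooth_along :: "'a::euclidean_space set \<Rightarrow> ('a \<Rightarrow> 'b::real_normed_vector) \<Rightarrow> bool"
  where "smooth_along S f \<longleftrightarrow>
    (\<forall>p\<in>S. \<exists>U g. open U \<and> p \<in> U \<and> smooth_on_open U g \<and> (\<forall>x\<in>S \<inter> U. f x = g x))"

subsection \<open>Smooth planar domains\<close>

definition local_defining_function ::
    "(real^2) set \<Rightarrow> real^2 \<Rightarrow> (real^2) set \<Rightarrow> (real^2 \<Rightarrow> real) \<Rightarrow> bool"
  where "local_defining_function \<Omega> p U \<phi> \<longleftrightarrow>
    open U \<and> p \<in> U \<and> smooth_on_open U \<phi> \<and>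
    (\<forall>x\<in>U. frechet_derivative \<phi> (at x) \<noteq> (\<lambda>_. 0)) \<and>
    \<Omega> \<inter> U = {x \<in> U. \<phi> x < 0} \<and>
    frontier \<Omega> \<inter> U = {x \<in> U. \<phi> x = 0}"

definition smooth_domain :: "(real^2) set \<Rightarrow> bool"
  where "smooth_domain \<Omega> \<longleftrightarrow>
    open \<Omega> \<and> connected \<Omega> \<and> \<Omega> \<noteq> {} \<and> compact (frontier \<Omega>) \<and>
    (\<forall>p\<in>frontier \<Omega>. \<exists>U \<phi>. local_defining_function \<Omega> p U \<phi>)"

text \<open>The normalised gradient does not depend on the local defining function, so the description
  below is unique at every boundary point of a smooth domain.\<close>

definition outer_normal :: "(real^2) set \<Rightarrow> real^2 \<Rightarrow> real^2"
  where "outer_normal \<Omega> p =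
    (THE \<nu>. \<exists>U \<phi> g. local_defining_function \<Omega> p U \<phi> \<and> GDERIV \<phi> p :> g \<and> \<nu> = sgn g)"

subsection \<open>Arc length measure on the boundary\<close>

text \<open>Arc length is the one-dimensional Hausdorff measure, defined through countable covers by sets
  of small diameter.  It is countably additive on Borel sets (Caratheodory's criterion for
  metric outer measures), as required for \<^const>\<open>measure_of\<close> to return it unchanged.\<close>

definition hausdorff1_delta :: "real \<Rightarrow> (real^2) set \<Rightarrow> ennreal"
  where "hausdorff1_delta \<delta> A =
    (INF C \<in> {C :: nat \<Rightarrow> (real^2) set. A \<subseteq> (\<Union>n. C n) \<and> (\<forall>n. bounded (C n) \<and> diameter (C n) \<le> \<delta>)}.
      \<Sum>n. ennreal (diameter (C n)))"

definition hausdorff1_outer :: "(real^2) set \<Rightarrow> ennreal"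
  where "hausdorff1_outer A = (SUP \<delta>\<in>{0<..}. hausdorff1_delta \<delta> A)"

definition arc_length :: "(real^2) set \<Rightarrow> (real^2) measure"
  where "arc_length \<Omega> = restrict_space (measure_of UNIV (sets borel) hausdorff1_outer) (frontier \<Omega>)"

subsection \<open>Square integrable densities and compact operators\<close>

text \<open>Elements of \<open>L\<^sup>2\<close> are represented by functions; equality is almost everywhere equality.\<close>

definition L2 :: "(real^2) measure \<Rightarrow> (real^2 \<Rightarrow> real^2) set"
  where "L2 M = {\<rho>. \<rho> \<in> borel_measurable M \<and> integrable M (\<lambda>x. (norm (\<rho> x))\<^sup>2)}"

definition L2_norm :: "(real^2) measure \<Rightarrow> (real^2 \<Rightarrow> real^2) \<Rightarrow> real"
  where "L2_norm M \<rho> = sqrt (\<integral>x. (norm (\<rho> x))\<^sup>2 \<partial>M)"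

definition compact_operator_L2 ::
    "(real^2) measure \<Rightarrow> ((real^2 \<Rightarrow> real^2) \<Rightarrow> (real^2 \<Rightarrow> real^2)) \<Rightarrow> bool"
  where "compact_operator_L2 M T \<longleftrightarrow>
    (\<forall>\<rho>\<in>L2 M. T \<rho> \<in> L2 M) \<and>
    (\<forall>\<rho>\<in>L2 M. \<forall>\<tau>\<in>L2 M. \<forall>a b. AE x in M.
       T (\<lambda>y. a *\<^sub>R \<rho> y + b *\<^sub>R \<tau> y) x = a *\<^sub>R T \<rho> x + b *\<^sub>R T \<tau> x) \<and>
    (\<forall>\<rho> :: nat \<Rightarrow> real^2 \<Rightarrow> real^2. \<forall>B.
       (\<forall>n. \<rho> n \<in> L2 M \<and> L2_norm M (\<rho> n) \<le> B) \<longrightarrow>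
       (\<exists>s g. strict_mono s \<and> g \<in> L2 M \<and>
          (\<lambda>n. L2_norm M (\<lambda>x. T (\<rho> (s n)) x - g x)) \<longlonglongrightarrow> 0))"

text \<open>A kernel takes \<open>x\<close>, \<open>y\<close> and the two component indices.\<close>

type_synonym kernel = "real^2 \<Rightarrow> real^2 \<Rightarrow> 2 \<Rightarrow> 2 \<Rightarrow> real"

definition kernel_op :: "(real^2) measure \<Rightarrow> kernel \<Rightarrow> (real^2 \<Rightarrow> real^2) \<Rightarrow> real^2 \<Rightarrow> real^2"
  where "kernel_op M k \<rho> x = (\<chi> i. \<integral>y. (\<Sum>l\<in>UNIV. k x y i l * \<rho> y $ l) \<partial>M)"

definition kernel_op_integrable ::
    "(real^2) measure \<Rightarrow> kernel \<Rightarrow> (real^2 \<Rightarrow> real^2) \<Rightarrow> real^2 \<Rightarrow> bool"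
  where "kernel_op_integrable M k \<rho> x \<longleftrightarrow>
    (\<forall>i. integrable M (\<lambda>y. \<Sum>l\<in>UNIV. k x y i l * \<rho> y $ l))"

subsection \<open>Stress\<close>

definition lame_alpha :: "real \<Rightarrow> real \<Rightarrow> real"
  where "lame_alpha lam \<mu> = (lam + \<mu>) / (lam + 2 * \<mu>)"

definition admissible_lame :: "real \<Rightarrow> real \<Rightarrow> bool"
  where "admissible_lame lam \<mu> \<longleftrightarrow> \<mu> > 0 \<and> 1/4 < lame_alpha lam \<mu> \<and> lame_alpha lam \<mu> < 1"

definition partial_deriv :: "2 \<Rightarrow> (real^2 \<Rightarrow> real) \<Rightarrow> real^2 \<Rightarrow> real"
  where "partial_deriv i u x = deriv (\<lambda>s. u (x + s *\<^sub>R axis i 1)) 0"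

definition stress :: "real \<Rightarrow> real \<Rightarrow> (real^2 \<Rightarrow> real^2) \<Rightarrow> real^2 \<Rightarrow> 2 \<Rightarrow> 2 \<Rightarrow> real"
  where "stress lam \<mu> u x i j =
    lam * (if i = j then 1 else 0) * (\<Sum>k\<in>UNIV. partial_deriv k (\<lambda>z. u z $ k) x)
    + \<mu> * (partial_deriv i (\<lambda>z. u z $ j) x + partial_deriv j (\<lambda>z. u z $ i) x)"

definition stress_matrix ::
    "real \<Rightarrow> real \<Rightarrow> (real^2 \<Rightarrow> real^2^2) \<Rightarrow> real^2 \<Rightarrow> 2 \<Rightarrow> 2 \<Rightarrow> 2 \<Rightarrow> real"
  where "stress_matrix lam \<mu> G x i j k = stress lam \<mu> (\<lambda>z. column k (G z)) x i j"

subsection \<open>The kernels\<close>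

text \<open>\<^const>\<open>Arg\<close> takes values in \<open>(-\<pi>, \<pi>]\<close>, so its branch cut is the negative real axis.\<close>

definition arg2 :: "real \<Rightarrow> real \<Rightarrow> real"
  where "arg2 u v = Arg (Complex v u)"

definition perp :: "real^2 \<Rightarrow> real^2"
  where "perp v = vector [v $ 2, - (v $ 1)]"

definition GB2 :: "real \<Rightarrow> real \<Rightarrow> real^2 \<Rightarrow> real^2 \<Rightarrow> real^2 \<Rightarrow> real^2^2"
  where "GB2 lam \<mu> x y v =
    (let r = x - y; \<alpha> = lame_alpha lam \<mu> in
      (1 / (2 * pi * \<mu>)) *\<^sub>R
        ((- ln (norm r)) *\<^sub>R mat 1 + (1 / (norm r)\<^sup>2) *\<^sub>R (\<chi> i k. r $ i * r $ k))
      + (1 / (2 * pi * \<mu>) * ((1 - \<alpha>) / \<alpha>)) *\<^sub>R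
        ((- ln (norm r)) *\<^sub>R mat 1
         + arg2 (perp v \<bullet> r) (- (v \<bullet> r)) *\<^sub>R vector [vector [0, 1], vector [-1, 0]]))"

text \<open>The derivative \<open>v \<cdot> \<nabla>\<^sub>z G(x, z; v)\<close> in the source variable \<open>z\<close>.  On the branch cut of the
  argument, \<open>G\<close> is not differentiable, but the singularity of the derivative along \<open>v\<close> is removable
  (except at \<open>z = x\<close>); there the value is the limit through points of differentiability.\<close>

definition source_deriv :: "real \<Rightarrow> real \<Rightarrow> real^2 \<Rightarrow> real^2 \<Rightarrow> real^2 \<Rightarrow> real^2^2"
  where "source_deriv lam \<mu> x z v =
    (let g = (\<lambda>w. GB2 lam \<mu> x w v) in
      if g differentiable (at z) then frechet_derivative g (at z) v
      else Lim (at z within {w. g differentiable (at w)}) (\<lambda>w. frechet_derivative g (at w) v))"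

definition KB2 :: "real \<Rightarrow> real \<Rightarrow> real^2 \<Rightarrow> real^2 \<Rightarrow> real^2 \<Rightarrow> real \<Rightarrow> real^2^2"
  where "KB2 lam \<mu> x y v h = - integral {0..h} (\<lambda>t. source_deriv lam \<mu> x (y + t *\<^sub>R v) v)"

text \<open>The indices are those of \<open>\<Sigma>\<^sub>j\<^sub>k = n\<^sub>i \<sigma>\<^sub>i\<^sub>j\<^sub>k\<close>.  Values on the diagonal \<open>x = y\<close> are irrelevant,
  because points have zero arc length.\<close>

definition SigmaB2 ::
    "real \<Rightarrow> real \<Rightarrow> (real^2) set \<Rightarrow> (real^2 \<Rightarrow> real) \<Rightarrow> kernel"
  where "SigmaB2 lam \<mu> \<Omega> h x y j k =
    (\<Sum>i\<in>UNIV. outer_normal \<Omega> x $ i *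
       stress_matrix lam \<mu> (\<lambda>z. KB2 lam \<mu> z y (outer_normal \<Omega> y) (h y)) x i j k)"

definition traction_kernel :: "real^2 \<Rightarrow> real^2 \<Rightarrow> 2 \<Rightarrow> 2 \<Rightarrow> real"
  where "traction_kernel \<nu> r i k = (\<Sum>j\<in>UNIV. \<nu> $ j * (r $ i * r $ j * r $ k / norm r ^ 4))"

definition near_kernel :: "(real^2) set \<Rightarrow> kernel"
  where "near_kernel \<Omega> x y = traction_kernel (outer_normal \<Omega> x) (x - y)"

definition far_kernel :: "(real^2) set \<Rightarrow> (real^2 \<Rightarrow> real) \<Rightarrow> kernel"
  where "far_kernel \<Omega> h x y =
    traction_kernel (outer_normal \<Omega> x) (x - (y + h y *\<^sub>R outer_normal \<Omega> y))"

subsection \<open>The integral equation\<close>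

definition equation_at ::
    "real \<Rightarrow> real \<Rightarrow> (real^2) set \<Rightarrow> (real^2 \<Rightarrow> real) \<Rightarrow> (real^2 \<Rightarrow> real^2) \<Rightarrow> (real^2 \<Rightarrow> real^2) \<Rightarrow> real^2 \<Rightarrow> bool"
  where "equation_at lam \<mu> \<Omega> h \<rho> f x \<longleftrightarrow>
    (\<forall>i. \<rho> x $ i + kernel_op (arc_length \<Omega>) (SigmaB2 lam \<mu> \<Omega> h) \<rho> x $ i = f x $ i)"

definition explicit_equation_at ::
    "(real^2) set \<Rightarrow> (real^2 \<Rightarrow> real) \<Rightarrow> (real^2 \<Rightarrow> real^2) \<Rightarrow> (real^2 \<Rightarrow> real^2) \<Rightarrow> real^2 \<Rightarrow> bool"
  where "explicit_equation_at \<Omega> h \<rho> f x \<longleftrightarrow>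
    (\<forall>i. 1/2 * \<rho> x $ i - 1/pi * kernel_op (arc_length \<Omega>) (near_kernel \<Omega>) \<rho> x $ i
       = 1/2 * f x $ i - 1/pi * kernel_op (arc_length \<Omega>) (far_kernel \<Omega> h) \<rho> x $ i)"

definition solves ::
    "real \<Rightarrow> real \<Rightarrow> (real^2) set \<Rightarrow> (real^2 \<Rightarrow> real) \<Rightarrow> (real^2 \<Rightarrow> real^2) \<Rightarrow> (real^2 \<Rightarrow> real^2) \<Rightarrow> bool"
  where "solves lam \<mu> \<Omega> h \<rho> f \<longleftrightarrow> (AE x in arc_length \<Omega>. equation_at lam \<mu> \<Omega> h \<rho> f x)"

end

theory Submission
  imports Defs "HOL-Complex_Analysis.Great_Picard"
begin

text \<open>
  The branch cut of the argument in \<open>G\<close> is parallel to the direction \<open>v\<close> of differentiation, so along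
  each line \<open>y + t v\<close> the integrand of \<open>K\<close> is a derivative, on the cut too, and
  \<open>K(x, y) = G(x, y) - G(x, y')\<close>; the two jumps of the argument cancel in this difference.  The value
  \<open>(1 - \<alpha>) / \<alpha> = \<mu> / (\<lambda> + \<mu>)\<close> makes all terms of the stress of \<open>G\<close> cancel except
  \<open>- 2 r\<^sub>i r\<^sub>j r\<^sub>k / (\<pi> |r|\<^sup>4)\<close>, which does not involve the Lame parameters.  At \<open>y\<close> this is the near kernel, bounded because
  chords are tangential to second order; at \<open>y'\<close>, which avoids the boundary, it is smooth, and
  Arzela-Ascoli gives compactness.
\<close>

subsection \<open>Line derivatives across the branch cut\<close>

text \<open>The first bracket of \<open>GB2\<close> is, up to a factor, the Stokes velocity kernel,
  whose columns are divergence free. So the second bracket supplies the whole divergence, and within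
  it the argument cancels the shear stress of the logarithm. What else is left on the diagonal
  vanishes exactly when c (lam + mu) = mu for c = (1 - alpha) / alpha. The obstacle is that a single
  argument is discontinuous across its cut, so \<open>GB2\<close> for one source point cannot be
  differentiated at every target. Only the difference of two arguments is: both cuts are rays on one
  line, and off the segment a target on this line lies on both of them or on neither. Arc length
  enters only through two upper bounds, finite total length and zero length of points. No
  parametrisation of the boundary is used, since a finite measure already puts \<open>L2\<close>
  into the integrable functions. The near kernel is bounded for each fixed x, which is what
  pointwise integrability asks for.\<close>

lemma DERIV_cong_nhds:
  assumes "(f has_real_derivative d) (at t)" "\<forall>\<^sub>F s in nhds t. f s = g s"
  shows "(g has_real_derivative d) (at t)"
  using DERIV_cong_ev[OF refl assms(2) refl] assms(1) by (rule iffD1)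

lemma isCont_imp_tendsto_nhds: "isCont g l \<Longrightarrow> (g \<longlongrightarrow> g l) (nhds l)"
  by (simp add: isCont_def tendsto_at_iff_tendsto_nhds)

text \<open>Off the closed negative real axis, which is what \<open>ne\<close> expresses,
  \<open>Arg\<close> is the imaginary part of the holomorphic \<open>Ln\<close>; the value is Im (z'
  / z) for the curve z.\<close>

lemma Arg_Complex_has_real_derivative:
  fixes a b :: "real \<Rightarrow> real"
  assumes a: "(a has_real_derivative a') (at t)" and b: "(b has_real_derivative b') (at t)"
    and ne: "b t \<noteq> 0 \<or> a t > 0"
  shows "((\<lambda>s. Arg (Complex (a s) (b s))) has_real_derivative
           (a t * b' - b t * a') / ((a t)\<^sup>2 + (b t)\<^sup>2)) (at t)"
proof -
  let ?\<gamma> = "\<lambda>s. Complex (a s) (b s)"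
  have nonpos: "?\<gamma> t \<notin> \<real>\<^sub>\<le>\<^sub>0"
    using ne by (auto simp: complex_nonpos_Reals_iff)
  have "((\<lambda>s. of_real (a s) + \<i> * of_real (b s)) has_vector_derivative (of_real a' + \<i> * of_real b')) (at t)"
    using a b by (auto intro!: derivative_eq_intros has_vector_derivative_of_real
        simp: has_real_derivative_iff_has_vector_derivative[symmetric])
  then have "(?\<gamma> has_vector_derivative Complex a' b') (at t)"
    by (simp add: Complex_eq)
  from field_vector_diff_chain_at[OF this has_field_derivative_Ln[OF nonpos]]
  have "((\<lambda>s. Ln (?\<gamma> s)) has_vector_derivative Complex a' b' * inverse (?\<gamma> t)) (at t)"
    by (simp add: o_def)
  from bounded_linear.has_vector_derivative[OF bounded_linear_Im this]
  have "((\<lambda>s. Im (Ln (?\<gamma> s))) has_real_derivative Im (Complex a' b' * inverse (?\<gamma> t))) (at t)"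
    by (simp add: has_real_derivative_iff_has_vector_derivative)
  moreover have "Im (Complex a' b' * inverse (?\<gamma> t)) = (a t * b' - b t * a') / ((a t)\<^sup>2 + (b t)\<^sup>2)"
    by (simp add: algebra_simps diff_divide_distrib)
  \<comment> \<open>\<open>Arg\<close> and Im Ln are identified only for nonzero arguments, so the
    curve must avoid 0 near t and not only at t.\<close>
  moreover have "\<forall>\<^sub>F s in nhds t. ?\<gamma> s \<noteq> 0"
  proof -
    have "isCont ?\<gamma> t"
      using \<open>(?\<gamma> has_vector_derivative _) (at t)\<close> has_vector_derivative_continuous by blast
    then have "(?\<gamma> \<longlongrightarrow> ?\<gamma> t) (nhds t)"
      by (rule isCont_imp_tendsto_nhds)
    moreover have "?\<gamma> t \<noteq> 0" using nonpos by auto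
    ultimately show ?thesis
      by (rule tendsto_imp_eventually_ne)
  qed
  then have "\<forall>\<^sub>F s in nhds t. Im (Ln (?\<gamma> s)) = Arg (?\<gamma> s)"
    by eventually_elim (simp add: Arg_eq_Im_Ln)
  ultimately show ?thesis
    by (simp only: DERIV_cong_nhds)
qed

text \<open>Two points with the same imaginary part cross the real axis together. If both real parts
  are negative there, both arguments jump by the same amount and the difference stays
  differentiable.\<close>

lemma Arg_Complex_diff_has_real_derivative:
  fixes a1 a2 b :: "real \<Rightarrow> real"
  assumes a1: "(a1 has_real_derivative a1') (at t)" and a2: "(a2 has_real_derivative a2') (at t)"
    and b: "(b has_real_derivative b') (at t)"
    and ne: "b t \<noteq> 0 \<or> a1 t * a2 t > 0"
  shows "((\<lambda>s. Arg (Complex (a1 s) (b s)) - Arg (Complex (a2 s) (b s))) has_real_derivative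
           (a1 t * b' - b t * a1') / ((a1 t)\<^sup>2 + (b t)\<^sup>2) - (a2 t * b' - b t * a2') / ((a2 t)\<^sup>2 + (b t)\<^sup>2)) (at t)"
proof (cases "b t \<noteq> 0 \<or> (a1 t > 0 \<and> a2 t > 0)")
  case True
  then show ?thesis
    by (intro DERIV_diff Arg_Complex_has_real_derivative assms) auto
next
  case False
  with ne have neg: "a1 t < 0" "a2 t < 0"
    by (auto simp: zero_less_mult_iff)
  \<comment> \<open>Negation moves the left half-plane to the right one, where \<open>Arg\<close> is
    smooth. The correction depends only on the sign of the common imaginary part, so it drops out of
    the difference; c = 0 goes with pi because \<open>Arg\<close> takes the value pi on the
    cut.\<close>
  have flip: "Arg (Complex a c) = Arg (Complex (-a) (-c)) + (if c \<ge> 0 then pi else - pi)"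
    if "a < 0" for a c :: real
  proof -
    have "Complex a c \<noteq> 0" and m: "Complex (-a) (-c) = - Complex a c"
      using that by (auto simp: complex_eq_iff)
    moreover have "Arg (Complex a c) \<noteq> 0"
      using that by (simp add: Arg_eq_0)
    moreover have "0 \<le> Arg (Complex a c) \<longleftrightarrow> 0 \<le> c"
      using Arg_less_0[of "Complex a c"] by simp
    ultimately show ?thesis
      using Arg_minus[of "Complex a c"] by (auto simp del: complex_minus simp: m)
  qed
  have "((\<lambda>s. Arg (Complex (- a1 s) (- b s)) - Arg (Complex (- a2 s) (- b s))) has_real_derivative
           ((- a1 t) * (- b') - (- b t) * (- a1')) / ((- a1 t)\<^sup>2 + (- b t)\<^sup>2)
           - ((- a2 t) * (- b') - (- b t) * (- a2')) / ((- a2 t)\<^sup>2 + (- b t)\<^sup>2)) (at t)"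
    using neg by (intro DERIV_diff Arg_Complex_has_real_derivative DERIV_minus assms) auto
  moreover have "\<forall>\<^sub>F s in nhds t. a1 s < 0 \<and> a2 s < 0"
  proof (rule eventually_conj)
    show "\<forall>\<^sub>F s in nhds t. a1 s < 0"
      using order_tendstoD(2)[OF isCont_imp_tendsto_nhds[OF DERIV_isCont[OF a1]]] neg by blast
    show "\<forall>\<^sub>F s in nhds t. a2 s < 0"
      using order_tendstoD(2)[OF isCont_imp_tendsto_nhds[OF DERIV_isCont[OF a2]]] neg by blast
  qed
  then have "\<forall>\<^sub>F s in nhds t. Arg (Complex (- a1 s) (- b s)) - Arg (Complex (- a2 s) (- b s))
      = Arg (Complex (a1 s) (b s)) - Arg (Complex (a2 s) (b s))"
    by eventually_elim (simp add: flip)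
  ultimately show ?thesis
    by (simp only: DERIV_cong_nhds minus_mult_minus power2_minus)
qed

section \<open>Derivative of the kernel along the source direction\<close>

lemma norm_vec2_sq: "(norm (r :: real^2))\<^sup>2 = (r $ 1)\<^sup>2 + (r $ 2)\<^sup>2"
  unfolding power2_norm_eq_inner by (simp add: inner_vec_def sum_2 power2_eq_square)

lemma has_real_derivative_ln_norm:
  fixes r :: "real \<Rightarrow> real^2"
  assumes "(r has_vector_derivative d) (at t)" "r t \<noteq> 0"
  shows "((\<lambda>s. ln (norm (r s))) has_real_derivative (r t \<bullet> d) / (norm (r t))\<^sup>2) (at t)"
proof -
  have "((\<lambda>s. norm (r s)) has_real_derivative (sgn (r t) \<bullet> d)) (at t)"
    using has_derivative_compose[OF assms(1)[unfolded has_vector_derivative_def] has_derivative_norm[OF assms(2)]]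
    by (auto simp: has_field_derivative_def inner_commute mult.commute elim!: has_derivative_eq_rhs)
  from DERIV_chain2[OF DERIV_ln this] assms(2) show ?thesis
    by (simp add: sgn_div_norm power2_eq_square field_simps)
qed

lemma GB2_component:
  "GB2 lam \<mu> x y v $ i $ k =
     1 / (2 * pi * \<mu>) * (- ln (norm (x - y)) * (if i = k then 1 else 0)
        + (x - y) $ i * (x - y) $ k / (norm (x - y))\<^sup>2)
     + 1 / (2 * pi * \<mu>) * ((1 - lame_alpha lam \<mu>) / lame_alpha lam \<mu>) *
       (- ln (norm (x - y)) * (if i = k then 1 else 0)
        + arg2 (perp v \<bullet> (x - y)) (- (v \<bullet> (x - y))) * vector [vector [0, 1], vector [-1, 0::real]] $ i $ k)"
  by (simp add: GB2_def Let_def mat_def)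

text \<open>The derivative of \<open>GB2\<close> along v in the source variable, with r the target
  minus the source. The argument contributes only its rate of change, so the formula has no branch
  cut and is continuous in r away from 0.\<close>

definition GB2_source_derivative :: "real \<Rightarrow> real \<Rightarrow> real^2 \<Rightarrow> real^2 \<Rightarrow> real^2^2"
  where "GB2_source_derivative lam \<mu> r v = (\<chi> i k.
     1 / (2 * pi * \<mu>) * ((v \<bullet> r) / (norm r)\<^sup>2 * (if i = k then 1 else 0)
        - (v $ i * r $ k + r $ i * v $ k) / (norm r)\<^sup>2 + 2 * (v \<bullet> r) * r $ i * r $ k / norm r ^ 4)
     + 1 / (2 * pi * \<mu>) * ((1 - lame_alpha lam \<mu>) / lame_alpha lam \<mu>) *
       ((v \<bullet> r) / (norm r)\<^sup>2 * (if i = k then 1 else 0)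
        - (perp v \<bullet> r) / (norm r)\<^sup>2 * vector [vector [0, 1], vector [-1, 0::real]] $ i $ k))"

lemma perp_inner: "perp v \<bullet> r = v $ 2 * r $ 1 - v $ 1 * r $ 2"
  by (simp add: perp_def inner_vec_def sum_2)

lemma perp_inner_self [simp]: "perp v \<bullet> v = 0"
  by (simp add: perp_inner)

lemma inner_sq_plus_perp_inner_sq:
  assumes "norm v = 1"
  shows "(v \<bullet> r)\<^sup>2 + (perp v \<bullet> r)\<^sup>2 = (norm r)\<^sup>2"
proof -
  have "(v \<bullet> r)\<^sup>2 + (perp v \<bullet> r)\<^sup>2 = (norm v)\<^sup>2 * (norm r)\<^sup>2"
    unfolding perp_inner norm_vec2_sq by (simp add: inner_vec_def sum_2 power2_eq_square algebra_simps)
  with assms show ?thesis by simp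
qed

lemma has_real_derivative_quotient_norm:
  fixes r :: "real \<Rightarrow> real^2"
  assumes r: "(r has_vector_derivative d) (at t)" and ne: "r t \<noteq> 0"
  shows "((\<lambda>s. r s $ i * r s $ k / (norm (r s))\<^sup>2) has_real_derivative
     (d $ i * r t $ k + r t $ i * d $ k) / (norm (r t))\<^sup>2 - 2 * (r t \<bullet> d) * r t $ i * r t $ k / norm (r t) ^ 4) (at t)"
proof -
  have comp: "((\<lambda>s. r s $ j) has_real_derivative d $ j) (at t)" for j
    using bounded_linear.has_vector_derivative[OF bounded_linear_vec_nth r]
    by (simp add: has_real_derivative_iff_has_vector_derivative)
  have "((\<lambda>s. r s \<bullet> r s) has_real_derivative 2 * (r t \<bullet> d)) (at t)"
    using bounded_bilinear.has_vector_derivative[OF bounded_bilinear_inner r r]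
    by (simp add: has_real_derivative_iff_has_vector_derivative inner_commute)
  then have "((\<lambda>s. (norm (r s))\<^sup>2) has_real_derivative 2 * (r t \<bullet> d)) (at t)"
    by (simp add: power2_norm_eq_inner)
  moreover have "(norm (r t))\<^sup>2 \<noteq> 0" using ne by simp
  ultimately have "((\<lambda>s. r s $ i * r s $ k / (norm (r s))\<^sup>2) has_real_derivative
     ((d $ i * r t $ k + d $ k * r t $ i) * (norm (r t))\<^sup>2 - (r t $ i * r t $ k) * (2 * (r t \<bullet> d)))
       / ((norm (r t))\<^sup>2 * (norm (r t))\<^sup>2)) (at t)"
    by (intro DERIV_divide DERIV_mult comp)
  moreover have "((d $ i * r t $ k + d $ k * r t $ i) * n - (r t $ i * r t $ k) * m) / (n * n)
     = (d $ i * r t $ k + r t $ i * d $ k) / n - m * r t $ i * r t $ k / n\<^sup>2" if "n \<noteq> 0" for n m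
    using that by (simp add: field_simps power2_eq_square)
  note this[OF \<open>(norm (r t))\<^sup>2 \<noteq> 0\<close>]
  moreover have "((norm (r t))\<^sup>2)\<^sup>2 = norm (r t) ^ 4" by simp
  ultimately show ?thesis by (simp only:)
qed

text \<open>A shift along v leaves perp v . r unchanged, so the complex number moves parallel to the
  real axis. If it lies on the axis, it moves along the cut or along the positive half, where the
  argument is constant, and the formula correctly gives 0.\<close>

lemma arg2_line_has_real_derivative:
  assumes v: "norm v = 1" and ne: "r \<noteq> 0"
  shows "((\<lambda>t. arg2 (perp v \<bullet> (r - t *\<^sub>R v)) (- (v \<bullet> (r - t *\<^sub>R v)))) has_real_derivative
     - (perp v \<bullet> r) / (norm r)\<^sup>2) (at 0)"
proof (cases "perp v \<bullet> r = 0")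
  case False
  have "((\<lambda>t. - (v \<bullet> r) + t) has_real_derivative 1) (at 0)"
    by (auto intro!: derivative_eq_intros)
  moreover have "((\<lambda>t. perp v \<bullet> r) has_real_derivative 0) (at 0)"
    by simp
  ultimately have "((\<lambda>t. Arg (Complex (- (v \<bullet> r) + t) (perp v \<bullet> r))) has_real_derivative
      ((- (v \<bullet> r) + 0) * 0 - (perp v \<bullet> r) * 1) / ((- (v \<bullet> r) + 0)\<^sup>2 + (perp v \<bullet> r)\<^sup>2)) (at 0)"
    by (rule Arg_Complex_has_real_derivative) (use False in simp)
  then show ?thesis
    using v inner_sq_plus_perp_inner_sq[OF v, of r]
    by (simp add: arg2_def inner_diff_right norm_eq_1)
next
  case True
  then have "v \<bullet> r \<noteq> 0"
    using inner_sq_plus_perp_inner_sq[OF v, of r] ne by auto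
  \<comment> \<open>Within this radius v . r - t keeps the sign of v . r, so the point does not pass
    through 0.\<close>
  have "\<forall>\<^sub>F t in nhds 0. \<bar>t\<bar> < \<bar>v \<bullet> r\<bar>"
    using \<open>v \<bullet> r \<noteq> 0\<close> unfolding eventually_nhds_metric by (intro exI[of _ "\<bar>v \<bullet> r\<bar>"]) auto
  then have "\<forall>\<^sub>F t in nhds 0. arg2 (perp v \<bullet> (r - t *\<^sub>R v)) (- (v \<bullet> (r - t *\<^sub>R v))) = (if v \<bullet> r > 0 then pi else 0)"
    by eventually_elim
      (use v True in \<open>auto simp: arg2_def inner_diff_right norm_eq_1 Arg_eq_pi Arg_eq_0 complex_is_Real_iff\<close>)
  then have "\<forall>\<^sub>F t in nhds 0. (if v \<bullet> r > 0 then pi else 0) = arg2 (perp v \<bullet> (r - t *\<^sub>R v)) (- (v \<bullet> (r - t *\<^sub>R v)))"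
    by eventually_elim simp
  from DERIV_cong_nhds[OF DERIV_const this] show ?thesis
    using True by simp
qed

lemma GB2_line_has_real_derivative:
  assumes v: "norm v = 1" and ne: "x \<noteq> z"
  shows "((\<lambda>t. GB2 lam \<mu> x (z + t *\<^sub>R v) v $ i $ k) has_real_derivative
     GB2_source_derivative lam \<mu> (x - z) v $ i $ k) (at 0)"
proof -
  define r where "r = x - z"
  have r: "((\<lambda>t. r - t *\<^sub>R v) has_vector_derivative - v) (at 0)"
    by (auto intro!: derivative_eq_intros)
  have ne: "r - 0 *\<^sub>R v \<noteq> 0" using ne by (simp add: r_def)
  note ders = has_real_derivative_ln_norm[OF r ne] has_real_derivative_quotient_norm[OF r ne]
    arg2_line_has_real_derivative[OF v]
  have eq: "x - (z + t *\<^sub>R v) = r - t *\<^sub>R v" for t by (simp add: r_def)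
  have "r \<noteq> 0" using ne by simp
  have deriv: "((\<lambda>t. A * (- ln (norm (r - t *\<^sub>R v)) * \<delta>
       + (r - t *\<^sub>R v) $ i * (r - t *\<^sub>R v) $ k / (norm (r - t *\<^sub>R v))\<^sup>2)
     + A * c * (- ln (norm (r - t *\<^sub>R v)) * \<delta>
       + arg2 (perp v \<bullet> (r - t *\<^sub>R v)) (- (v \<bullet> (r - t *\<^sub>R v))) * J)) has_real_derivative
     A * (- ((r - 0 *\<^sub>R v) \<bullet> (- v) / (norm (r - 0 *\<^sub>R v))\<^sup>2) * \<delta>
       + (((- v) $ i * (r - 0 *\<^sub>R v) $ k + (r - 0 *\<^sub>R v) $ i * (- v) $ k) / (norm (r - 0 *\<^sub>R v))\<^sup>2
          - 2 * ((r - 0 *\<^sub>R v) \<bullet> (- v)) * (r - 0 *\<^sub>R v) $ i * (r - 0 *\<^sub>R v) $ k / norm (r - 0 *\<^sub>R v) ^ 4))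
     + A * c * (- ((r - 0 *\<^sub>R v) \<bullet> (- v) / (norm (r - 0 *\<^sub>R v))\<^sup>2) * \<delta>
       + (- (perp v \<bullet> r) / (norm r)\<^sup>2) * J)) (at 0)" for A c \<delta> J
    by (intro DERIV_add DERIV_cmult DERIV_cmult_right DERIV_minus ders \<open>r \<noteq> 0\<close>)
  have "A * (- (r \<bullet> (- v) / n) * \<delta>
       + (((- v) $ i * r $ k + r $ i * (- v) $ k) / n - 2 * (r \<bullet> (- v)) * r $ i * r $ k / m))
     + B * (- (r \<bullet> (- v) / n) * \<delta> + (- p / n) * J)
    = A * ((v \<bullet> r) / n * \<delta> - (v $ i * r $ k + r $ i * v $ k) / n + 2 * (v \<bullet> r) * r $ i * r $ k / m)
     + B * ((v \<bullet> r) / n * \<delta> - p / n * J)" for A B \<delta> J n m p :: real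
    by (simp add: inner_commute[of r v] add_divide_distrib diff_divide_distrib)
  with deriv show ?thesis unfolding GB2_component eq r_def[symmetric] GB2_source_derivative_def vec_lambda_beta
    by (simp only: scaleR_zero_left diff_zero)
qed

lemma GB2_line_has_real_derivative_at:
  assumes v: "norm v = 1" and ne: "x \<noteq> z + t *\<^sub>R v"
  shows "((\<lambda>s. GB2 lam \<mu> x (z + s *\<^sub>R v) v $ i $ k) has_real_derivative
     GB2_source_derivative lam \<mu> (x - (z + t *\<^sub>R v)) v $ i $ k) (at t)"
proof -
  have eq: "z + t *\<^sub>R v + s *\<^sub>R v = z + (s + t) *\<^sub>R v" for s
    by (simp add: scaleR_add_left)
  have "((\<lambda>s. GB2 lam \<mu> x (z + (s + t) *\<^sub>R v) v $ i $ k) has_real_derivative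
     GB2_source_derivative lam \<mu> (x - (z + t *\<^sub>R v)) v $ i $ k) (at 0)"
    using GB2_line_has_real_derivative[OF v ne, unfolded eq] .
  then show ?thesis
    using DERIV_shift[of "\<lambda>s. GB2 lam \<mu> x (z + s *\<^sub>R v) v $ i $ k" _ 0 t] by simp
qed

lemma has_vector_derivative_matrixI:
  fixes F :: "real \<Rightarrow> real^'n^'m"
  assumes "\<And>i k. ((\<lambda>t. F t $ i $ k) has_real_derivative D $ i $ k) (at t within S)"
  shows "(F has_vector_derivative D) (at t within S)"
  unfolding has_vector_derivative_def
proof (subst has_derivative_componentwise_within, intro ballI)
  fix b :: "real^'n^'m" assume "b \<in> Basis"
  then obtain i k where "b = axis i (axis k 1)" by (auto simp: Basis_vec_def)
  then show "((\<lambda>x. F x \<bullet> b) has_derivative (\<lambda>x. (x *\<^sub>R D) \<bullet> b)) (at t within S)"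
    using assms[of i k] by (simp add: inner_axis has_field_derivative_def mult_commute_abs)
qed

text \<open>Where a full derivative exists, its value in direction v is forced by the restriction to
  the line. This gives one formula for all points of differentiability.\<close>

lemma frechet_derivative_GB2:
  assumes v: "norm v = 1" and ne: "x \<noteq> z" and diff: "(\<lambda>w. GB2 lam \<mu> x w v) differentiable (at z)"
  shows "frechet_derivative (\<lambda>w. GB2 lam \<mu> x w v) (at z) v = GB2_source_derivative lam \<mu> (x - z) v"
proof -
  let ?g = "\<lambda>w. GB2 lam \<mu> x w v"
  have "((\<lambda>t. z + t *\<^sub>R v) has_vector_derivative v) (at 0)"
    by (auto intro!: derivative_eq_intros)
  moreover have "(?g has_derivative frechet_derivative ?g (at z)) (at (z + 0 *\<^sub>R v))"
    using diff by (simp add: frechet_derivative_works)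
  ultimately have "((\<lambda>t. ?g (z + t *\<^sub>R v)) has_vector_derivative frechet_derivative ?g (at z) v) (at 0)"
    using vector_derivative_diff_chain_within[of "\<lambda>t. z + t *\<^sub>R v" v 0 UNIV ?g] 
    by (simp add: o_def has_derivative_at_withinI)
  moreover have "((\<lambda>t. ?g (z + t *\<^sub>R v)) has_vector_derivative GB2_source_derivative lam \<mu> (x - z) v) (at 0)"
    by (intro has_vector_derivative_matrixI GB2_line_has_real_derivative v ne)
  ultimately show ?thesis by (rule vector_derivative_unique_at)
qed

lemma bounded_linear_compose_differentiable:
  "bounded_linear f \<Longrightarrow> g differentiable F \<Longrightarrow> (\<lambda>x. f (g x)) differentiable F"
  unfolding differentiable_def using bounded_linear.has_derivative by blast

text \<open>The hypothesis excludes the whole line through x in direction v rather than only the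
  half that carries the cut. The remaining set is still dense, which is enough for the limit in
  \<open>source_deriv\<close>.\<close>

lemma GB2_differentiable:
  assumes "perp v \<bullet> (x - z) \<noteq> 0"
  shows "(\<lambda>w. GB2 lam \<mu> x w v) differentiable (at z)"
proof -
  have ne: "x - z \<noteq> 0" using assms by auto
  let ?\<gamma> = "\<lambda>w. of_real (- (v \<bullet> (x - w))) + \<i> * of_real (perp v \<bullet> (x - w))"
  have nonpos: "?\<gamma> z \<notin> \<real>\<^sub>\<le>\<^sub>0" using assms by (auto simp: complex_nonpos_Reals_iff)
  have "?\<gamma> differentiable (at z)"
    by (intro differentiable_add differentiable_mult differentiable_const
      bounded_linear_compose_differentiable[OF bounded_linear_of_real] differentiable_minus differentiable_inner differentiable_diff differentiable_ident)
  then obtain \<gamma>' where "(?\<gamma> has_derivative \<gamma>') (at z)"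
    unfolding differentiable_def ..
  from has_derivative_compose[OF this has_field_derivative_imp_has_derivative[OF has_field_derivative_Ln[OF nonpos]]]
  have "((\<lambda>w. Im (Ln (?\<gamma> w))) has_derivative (\<lambda>h. Im (inverse (?\<gamma> z) * \<gamma>' h))) (at z)"
    by (rule has_derivative_Im)
  moreover have "\<forall>\<^sub>F w in nhds z. perp v \<bullet> (x - w) \<noteq> 0"
    using assms by (intro tendsto_imp_eventually_ne[of _ "perp v \<bullet> (x - z)"]) (auto intro!: tendsto_intros filterlim_ident)
  then have "\<forall>\<^sub>F w in at z. Im (Ln (?\<gamma> w)) = arg2 (perp v \<bullet> (x - w)) (- (v \<bullet> (x - w)))"
    unfolding eventually_at_filter
    by eventually_elim (subst Arg_eq_Im_Ln[symmetric]; auto simp: arg2_def Complex_eq complex_eq_iff)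
  moreover have "Im (Ln (?\<gamma> z)) = arg2 (perp v \<bullet> (x - z)) (- (v \<bullet> (x - z)))"
    using assms by (subst Arg_eq_Im_Ln[symmetric]) (auto simp: arg2_def Complex_eq complex_eq_iff)
  ultimately have "((\<lambda>w. arg2 (perp v \<bullet> (x - w)) (- (v \<bullet> (x - w)))) has_derivative (\<lambda>h. Im (inverse (?\<gamma> z) * \<gamma>' h))) (at z)"
    by (rule has_derivative_transform_eventually) simp
  then have "(\<lambda>w. arg2 (perp v \<bullet> (x - w)) (- (v \<bullet> (x - w)))) differentiable (at z)"
    by (rule differentiableI)
  moreover have "(\<lambda>w. norm (x - w)) differentiable (at z)"
    using differentiable_compose[of norm "\<lambda>w. x - w" z UNIV] differentiable_norm_at[OF ne] by simp
  moreover have "(\<lambda>w. ln (norm (x - w))) differentiable (at z)"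
    using differentiable_compose[of ln "\<lambda>w. norm (x - w)" z UNIV] \<open>(\<lambda>w. norm (x - w)) differentiable (at z)\<close> ne
    by (simp add: DERIV_ln[THEN has_field_derivative_imp_has_derivative, THEN differentiableI])
  moreover have "(\<lambda>w. (x - w) $ i) differentiable (at z)" for i
    by (intro bounded_linear_compose_differentiable[OF bounded_linear_vec_nth] differentiable_diff differentiable_const differentiable_ident)
  ultimately have "(\<lambda>w. GB2 lam \<mu> x w v $ i $ k) differentiable (at z)" for i k
    unfolding GB2_component using ne
    by (intro differentiable_add differentiable_mult differentiable_divide differentiable_power
      differentiable_minus differentiable_const) auto
  then show ?thesis
    by (subst differentiable_componentwise_within) (auto simp: Basis_vec_def inner_axis)
qed

text \<open>If z is no point of differentiability, it lies on the line of the cut. Steps in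
  direction perp v leave this line, so z is a limit point of the set of differentiability and the
  \<open>Lim\<close> is determined; it is the value of the line formula, which is continuous at z
  because z differs from x.\<close>

lemma source_deriv_eq:
  assumes v: "norm v = 1" and ne: "x \<noteq> z"
  shows "source_deriv lam \<mu> x z v = GB2_source_derivative lam \<mu> (x - z) v"
proof (cases "(\<lambda>w. GB2 lam \<mu> x w v) differentiable (at z)")
  case True
  then show ?thesis
    using frechet_derivative_GB2[OF v ne] by (simp add: source_deriv_def Let_def)
next
  case False
  let ?g = "\<lambda>w. GB2 lam \<mu> x w v"
  let ?S = "{w. ?g differentiable (at w)}"
  have cut: "perp v \<bullet> (x - z) = 0"
    using False GB2_differentiable by blast
  have perp_perp: "perp v \<bullet> perp v = 1"
    using v norm_vec2_sq[of v] by (simp add: perp_inner) (simp add: perp_def power2_eq_square)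
  have "z islimpt ?S"
    unfolding islimpt_approachable
  proof (intro allI impI)
    fix e :: real assume "e > 0"
    let ?w = "z + (e/2) *\<^sub>R perp v"
    have "perp v \<bullet> (x - ?w) \<noteq> 0"
      using cut perp_perp \<open>e > 0\<close> by (simp add: inner_diff_right inner_add_right)
    moreover have "norm (perp v) = 1" using perp_perp by (simp add: norm_eq_1)
    ultimately show "\<exists>w\<in>?S. w \<noteq> z \<and> dist w z < e"
      using \<open>e > 0\<close> GB2_differentiable by (intro bexI[of _ ?w]) (auto simp: dist_norm)
  qed
  then have "\<not> trivial_limit (at z within ?S)"
    by (simp add: trivial_limit_within)
  moreover have "((\<lambda>w. frechet_derivative ?g (at w) v) \<longlongrightarrow> GB2_source_derivative lam \<mu> (x - z) v) (at z within ?S)"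
  proof (rule Lim_transform_eventually)
    show "((\<lambda>w. GB2_source_derivative lam \<mu> (x - w) v) \<longlongrightarrow> GB2_source_derivative lam \<mu> (x - z) v) (at z within ?S)"
      unfolding GB2_source_derivative_def using ne
      by (intro tendsto_intros) auto
    have "\<forall>\<^sub>F w in at z within ?S. w \<noteq> x"
      using ne by (intro tendsto_imp_eventually_ne[OF tendsto_ident_at]) auto
    moreover have "\<forall>\<^sub>F w in at z within ?S. w \<in> ?S"
      by (simp add: eventually_at_filter)
    ultimately show "\<forall>\<^sub>F w in at z within ?S. GB2_source_derivative lam \<mu> (x - w) v = frechet_derivative ?g (at w) v"
      by eventually_elim (metis frechet_derivative_GB2 v mem_Collect_eq)
  qed
  ultimately show ?thesis
    using False by (simp add: source_deriv_def Let_def tendsto_Lim)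
qed

lemma KB2_eq_diff:
  assumes v: "norm v = 1" and h: "h \<ge> 0" and off: "x \<notin> {y + t *\<^sub>R v | t. t \<in> {0..h}}"
  shows "KB2 lam \<mu> x y v h = GB2 lam \<mu> x y v - GB2 lam \<mu> x (y + h *\<^sub>R v) v"
proof -
  have "((\<lambda>t. source_deriv lam \<mu> x (y + t *\<^sub>R v) v) has_integral
      GB2 lam \<mu> x (y + h *\<^sub>R v) v - GB2 lam \<mu> x (y + 0 *\<^sub>R v) v) {0..h}"
  proof (rule fundamental_theorem_of_calculus[OF h])
    fix t assume t: "t \<in> {0..h}"
    with off have ne: "x \<noteq> y + t *\<^sub>R v" by blast
    show "((\<lambda>s. GB2 lam \<mu> x (y + s *\<^sub>R v) v) has_vector_derivative
        source_deriv lam \<mu> x (y + t *\<^sub>R v) v) (at t within {0..h})"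
      by (rule has_vector_derivative_at_within, rule has_vector_derivative_matrixI)
        (simp add: source_deriv_eq[OF v ne] GB2_line_has_real_derivative_at[OF v ne])
  qed
  then show ?thesis
    by (simp add: KB2_def integral_unique)
qed

subsection \<open>Stress of the kernel\<close>

text \<open>\<open>A\<close> and \<open>c\<close> stand for \<open>1 / (2 \<pi> \<mu>)\<close> and \<open>(1 - \<alpha>) / \<alpha>\<close>.\<close>

definition GB2_partial :: "real \<Rightarrow> real \<Rightarrow> real^2 \<Rightarrow> 2 \<Rightarrow> 2 \<Rightarrow> 2 \<Rightarrow> real"
  where "GB2_partial A c r m i k =
     A * (- (r $ m / (norm r)\<^sup>2) * (if i = k then 1 else 0)
        + (((if i = m then 1 else 0) * r $ k + r $ i * (if k = m then 1 else 0)) / (norm r)\<^sup>2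
           - 2 * r $ m * r $ i * r $ k / norm r ^ 4))
     + A * c * (- (r $ m / (norm r)\<^sup>2) * (if i = k then 1 else 0)
        + (if m = 1 then - (r $ 2) else r $ 1) / (norm r)\<^sup>2 * vector [vector [0, 1], vector [-1, 0::real]] $ i $ k)"

text \<open>With u for the inverse square of the norm, all entries are polynomials in the two
  components a, b of r and in u, subject to the single relation (a a + b b) u = 1. Each index triple
  is then a polynomial consequence of that relation, \<open>\<mu>A\<close> and \<open>cA\<close>;
  the latter two encode c = mu / (lam + mu). In the application B is 1 / (2 pi).\<close>

lemma GB2_partial_stress:
  assumes \<mu>A: "\<mu> * A = B" and cA: "A * c * (lam + \<mu>) = B" and ne: "r \<noteq> 0"
  shows "lam * (if i = j then 1 else 0) * (\<Sum>m\<in>UNIV. GB2_partial A c r m m k)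
      + \<mu> * (GB2_partial A c r i j k + GB2_partial A c r j i k)
    = - 4 * B * (r $ i * r $ j * r $ k / norm r ^ 4)"
proof -
  define u where "u = 1 / (norm r)\<^sup>2"
  define a b where "a = r $ 1" and "b = r $ 2"
  have "(norm r)\<^sup>2 \<noteq> 0" using ne by simp
  then have u: "(a * a + b * b) * u = 1"
    unfolding u_def norm_vec2_sq a_def b_def by (simp add: power2_eq_square)
  have div2: "t / (norm r)\<^sup>2 = t * u" for t by (simp add: u_def)
  have "norm r ^ 4 = (norm r)\<^sup>2 * (norm r)\<^sup>2" by (simp flip: power_add)
  then have div4: "t / norm r ^ 4 = t * u * u" for t by (simp add: u_def)
  have P: "GB2_partial A c r 1 1 1 = A * (- (a * u) + (a + a) * u - 2 * a * a * a * u * u) + A * c * (- (a * u))"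
    "GB2_partial A c r 1 1 2 = A * ((b) * u - 2 * a * a * b * u * u) + A * c * ((- b) * u)"
    "GB2_partial A c r 1 2 1 = A * ((b) * u - 2 * a * b * a * u * u) + A * c * (- (- b) * u)"
    "GB2_partial A c r 1 2 2 = A * (- (a * u) - 2 * a * b * b * u * u) + A * c * (- (a * u))"
    "GB2_partial A c r 2 1 1 = A * (- (b * u) - 2 * b * a * a * u * u) + A * c * (- (b * u))"
    "GB2_partial A c r 2 1 2 = A * ((a) * u - 2 * b * a * b * u * u) + A * c * (a * u)"
    "GB2_partial A c r 2 2 1 = A * ((a) * u - 2 * b * b * a * u * u) + A * c * (- a * u)"
    "GB2_partial A c r 2 2 2 = A * (- (b * u) + (b + b) * u - 2 * b * b * b * u * u) + A * c * (- (b * u))"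
    by (simp_all add: GB2_partial_def div2 div4 flip: a_def b_def)
  have "(\<Sum>m\<in>UNIV. GB2_partial A c r m m k) = GB2_partial A c r 1 1 k + GB2_partial A c r 2 2 k"
    by (simp add: sum_2)
  moreover consider "i = 1" "j = 1" "k = 1" | "i = 1" "j = 1" "k = 2" | "i = 1" "j = 2" "k = 1" | "i = 1" "j = 2" "k = 2"
    | "i = 2" "j = 1" "k = 1" | "i = 2" "j = 1" "k = 2" | "i = 2" "j = 2" "k = 1" | "i = 2" "j = 2" "k = 2"
    by (metis exhaust_2)
  then have "(if i = j then lam else 0) * (GB2_partial A c r 1 1 k + GB2_partial A c r 2 2 k)
      + \<mu> * (GB2_partial A c r i j k + GB2_partial A c r j i k)
    = - 4 * B * (r $ i * r $ j * r $ k * u * u)"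
  proof cases
    case 1
    have "lam * (GB2_partial A c r 1 1 1 + GB2_partial A c r 2 2 1) + \<mu> * (GB2_partial A c r 1 1 1 + GB2_partial A c r 1 1 1) = - 4 * B * (a * a * a * u * u)"
      unfolding P using u \<mu>A cA by algebra
    with 1 show ?thesis by (simp add: a_def b_def)
  next
    case 2
    have "lam * (GB2_partial A c r 1 1 2 + GB2_partial A c r 2 2 2) + \<mu> * (GB2_partial A c r 1 1 2 + GB2_partial A c r 1 1 2) = - 4 * B * (a * a * b * u * u)"
      unfolding P using u \<mu>A cA by algebra
    with 2 show ?thesis by (simp add: a_def b_def)
  next
    case 3
    have "\<mu> * (GB2_partial A c r 1 2 1 + GB2_partial A c r 2 1 1) = - 4 * B * (a * b * a * u * u)"
      unfolding P using u \<mu>A cA by algebra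
    with 3 show ?thesis by (simp add: a_def b_def)
  next
    case 4
    have "\<mu> * (GB2_partial A c r 1 2 2 + GB2_partial A c r 2 1 2) = - 4 * B * (a * b * b * u * u)"
      unfolding P using u \<mu>A cA by algebra
    with 4 show ?thesis by (simp add: a_def b_def)
  next
    case 5
    have "\<mu> * (GB2_partial A c r 2 1 1 + GB2_partial A c r 1 2 1) = - 4 * B * (b * a * a * u * u)"
      unfolding P using u \<mu>A cA by algebra
    with 5 show ?thesis by (simp add: a_def b_def)
  next
    case 6
    have "\<mu> * (GB2_partial A c r 2 1 2 + GB2_partial A c r 1 2 2) = - 4 * B * (b * a * b * u * u)"
      unfolding P using u \<mu>A cA by algebra
    with 6 show ?thesis by (simp add: a_def b_def)
  next
    case 7
    have "lam * (GB2_partial A c r 1 1 1 + GB2_partial A c r 2 2 1) + \<mu> * (GB2_partial A c r 2 2 1 + GB2_partial A c r 2 2 1) = - 4 * B * (b * b * a * u * u)"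
      unfolding P using u \<mu>A cA by algebra
    with 7 show ?thesis by (simp add: a_def b_def)
  next
    case 8
    have "lam * (GB2_partial A c r 1 1 2 + GB2_partial A c r 2 2 2) + \<mu> * (GB2_partial A c r 2 2 2 + GB2_partial A c r 2 2 2) = - 4 * B * (b * b * b * u * u)"
      unfolding P using u \<mu>A cA by algebra
    with 8 show ?thesis by (simp add: a_def b_def)
  qed
  ultimately show ?thesis by (cases "i = j") (simp_all add: div4)
qed

lemma perp_inner_eq_0_imp_parallel:
  assumes "norm v = 1" "perp v \<bullet> r = 0"
  shows "r = (v \<bullet> r) *\<^sub>R v"
proof -
  have "v $ 1 * v $ 1 + v $ 2 * v $ 2 = 1"
    using assms(1) norm_vec2_sq[of v] by (simp add: power2_eq_square)
  moreover have "v $ 2 * r $ 1 = v $ 1 * r $ 2"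
    using assms(2) by (simp add: perp_inner)
  ultimately have "r $ 1 = (v $ 1 * r $ 1 + v $ 2 * r $ 2) * v $ 1" "r $ 2 = (v $ 1 * r $ 1 + v $ 2 * r $ 2) * v $ 2"
    by algebra+
  then show ?thesis
    by (simp add: vec_eq_iff forall_2 inner_vec_def sum_2)
qed

text \<open>The gradient of an angle does not depend on the axis from which it is measured, so v
  disappears from the result. The two arguments belong to r and r - h v, which have the same perp v
  component; this is the common imaginary part that
  \<open>Arg_Complex_diff_has_real_derivative\<close> asks for.\<close>

lemma arg2_diff_has_real_derivative:
  assumes v: "norm v = 1" and h: "h > 0" and off: "\<And>t. t \<in> {0..h} \<Longrightarrow> r \<noteq> t *\<^sub>R v"
  shows "((\<lambda>s. arg2 (perp v \<bullet> (r + s *\<^sub>R axis m 1)) (- (v \<bullet> (r + s *\<^sub>R axis m 1)))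
      - arg2 (perp v \<bullet> (r - h *\<^sub>R v + s *\<^sub>R axis m 1)) (- (v \<bullet> (r - h *\<^sub>R v + s *\<^sub>R axis m 1)))) has_real_derivative
     (if m = 1 then - (r $ 2) else r $ 1) / (norm r)\<^sup>2
     - (if m = 1 then - ((r - h *\<^sub>R v) $ 2) else (r - h *\<^sub>R v) $ 1) / (norm (r - h *\<^sub>R v))\<^sup>2) (at 0)"
proof -
  let ?e = "axis m (1::real)"
  define q where "q = r - h *\<^sub>R v"
  have vv: "v \<bullet> v = 1" using v by (simp add: norm_eq_1)
  have pq: "perp v \<bullet> q = perp v \<bullet> r" by (simp add: q_def inner_diff_right)
  have a: "((\<lambda>s. - (v \<bullet> p) - s * v $ m) has_real_derivative - v $ m) (at 0)" for p
    by (auto intro!: derivative_eq_intros)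
  have b: "((\<lambda>s. perp v \<bullet> r + s * perp v $ m) has_real_derivative perp v $ m) (at 0)"
    by (auto intro!: derivative_eq_intros)
  have ne: "perp v \<bullet> r + 0 * perp v $ m \<noteq> 0 \<or> (- (v \<bullet> r) - 0 * v $ m) * (- (v \<bullet> q) - 0 * v $ m) > 0"
  proof (cases "perp v \<bullet> r = 0")
    case True
    \<comment> \<open>On the line of the segment r = (v . r) v, so a target off the segment lies
      beyond one of its ends, and v . r and v . r - h have the same sign.\<close>
    have "v \<bullet> r \<notin> {0..h}"
      using perp_inner_eq_0_imp_parallel[OF v True] off[of "v \<bullet> r"] by argo
    then have "v \<bullet> r < 0 \<or> v \<bullet> r > h" by auto
    then have "(v \<bullet> r) * (v \<bullet> r - h) > 0"
      using h by (auto intro: mult_neg_neg mult_pos_pos)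
    moreover have "v \<bullet> q = v \<bullet> r - h" by (simp add: q_def inner_diff_right vv)
    ultimately show ?thesis
      by (intro disjI2) (simp only: mult_zero_left diff_zero minus_mult_minus)
  qed simp
  have expand: "arg2 (perp v \<bullet> (p + s *\<^sub>R ?e)) (- (v \<bullet> (p + s *\<^sub>R ?e)))
      = Arg (Complex (- (v \<bullet> p) - s * v $ m) (perp v \<bullet> p + s * perp v $ m))" for p s
    by (simp add: arg2_def inner_add_right inner_axis)
  have simple: "((- (v \<bullet> p) - 0 * v $ m) * perp v $ m - (perp v \<bullet> p + 0 * perp v $ m) * (- v $ m))
       / ((- (v \<bullet> p) - 0 * v $ m)\<^sup>2 + (perp v \<bullet> p + 0 * perp v $ m)\<^sup>2)
     = (if m = 1 then - (p $ 2) else p $ 1) / (norm p)\<^sup>2" for p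
  proof -
    have "v $ 1 * v $ 1 + v $ 2 * v $ 2 = 1"
      using v norm_vec2_sq[of v] by (simp add: power2_eq_square)
    moreover have "- (a * s + b * t) * b - (b * s - a * t) * (- a) = - t" "- (a * s + b * t) * (- a) - (b * s - a * t) * (- b) = s"
      if "a * a + b * b = 1" for a b s t :: real
      using that by algebra+
    moreover have "(2::2) \<noteq> 1" by simp
    moreover have "v \<bullet> p = v $ 1 * p $ 1 + v $ 2 * p $ 2" "perp v $ 1 = v $ 2" "perp v $ 2 = - v $ 1"
      by (simp_all add: perp_def inner_vec_def sum_2)
    ultimately have "- (v \<bullet> p) * perp v $ 1 - (perp v \<bullet> p) * (- v $ 1) = - (p $ 2)"
      "- (v \<bullet> p) * perp v $ 2 - (perp v \<bullet> p) * (- v $ 2) = p $ 1"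
      unfolding perp_inner by (simp_all only:)
    then have "- (v \<bullet> p) * perp v $ m - (perp v \<bullet> p) * (- v $ m) = (if m = 1 then - (p $ 2) else p $ 1)"
      using exhaust_2[of m] \<open>(2::2) \<noteq> 1\<close> by (elim disjE) (simp_all only: if_True if_False simp_thms)
    then show ?thesis
      by (simp only: inner_sq_plus_perp_inner_sq[OF v, of p, symmetric] mult_zero_left diff_zero add_0_right power2_minus)
  qed
  have "((\<lambda>s. Arg (Complex (- (v \<bullet> r) - s * v $ m) (perp v \<bullet> r + s * perp v $ m))
     - Arg (Complex (- (v \<bullet> q) - s * v $ m) (perp v \<bullet> r + s * perp v $ m))) has_real_derivative
     (if m = 1 then - (r $ 2) else r $ 1) / (norm r)\<^sup>2 - (if m = 1 then - (q $ 2) else q $ 1) / (norm q)\<^sup>2) (at 0)"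
    by (rule DERIV_cong[OF Arg_Complex_diff_has_real_derivative[OF a a b ne]])
      (simp only: simple[of r] simple[of q, unfolded pq])
  then show ?thesis
    unfolding q_def[symmetric] expand pq .
qed

text \<open>The kernel is split into a part \<Phi>, differentiable away from 0 at each source
  separately, and the argument \<Theta>, which is differentiated only as a difference. The result is
  regrouped into one \<open>GB2_partial\<close> per source, although \<Theta> alone may be
  discontinuous.\<close>

lemma partial_deriv_KB2:
  assumes v: "norm v = 1" and h: "h > 0" and off: "x \<notin> {y + t *\<^sub>R v | t. t \<in> {0..h}}"
    and A: "A = 1 / (2 * pi * \<mu>)" and c: "c = (1 - lame_alpha lam \<mu>) / lame_alpha lam \<mu>"
  shows "partial_deriv m (\<lambda>z. KB2 lam \<mu> z y v h $ i $ k) x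
    = GB2_partial A c (x - y) m i k - GB2_partial A c (x - (y + h *\<^sub>R v)) m i k"
proof -
  let ?e = "axis m (1::real)"
  define r where "r = x - y"
  define J where "J = vector [vector [0, 1], vector [-1, 0::real]] $ i $ k"
  define \<delta> :: real where "\<delta> = (if i = k then 1 else 0)"
  define \<Phi> where "\<Phi> p = A * (- ln (norm p) * \<delta> + p $ i * p $ k / (norm p)\<^sup>2) + A * c * (- ln (norm p) * \<delta>)" for p :: "real^2"
  define \<Theta> where "\<Theta> p = arg2 (perp v \<bullet> p) (- (v \<bullet> p))" for p
  have off': "r \<noteq> t *\<^sub>R v" if "t \<in> {0..h}" for t
  proof
    assume "r = t *\<^sub>R v"
    then have "x = y + t *\<^sub>R v" by (simp add: r_def diff_eq_eq add.commute)
    with off that show False by blast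
  qed
  have r0: "r \<noteq> 0" "r - h *\<^sub>R v \<noteq> 0"
    using off'[of 0] off'[of h] h by auto
  have \<Phi>: "((\<lambda>s. \<Phi> (p + s *\<^sub>R ?e)) has_real_derivative
      A * (- (p $ m / (norm p)\<^sup>2) * \<delta>
        + (((if i = m then 1 else 0) * p $ k + p $ i * (if k = m then 1 else 0)) / (norm p)\<^sup>2
           - 2 * p $ m * p $ i * p $ k / norm p ^ 4))
      + A * c * (- (p $ m / (norm p)\<^sup>2) * \<delta>)) (at 0)" if "p \<noteq> 0" for p
  proof -
    have d: "((\<lambda>s. p + s *\<^sub>R ?e) has_vector_derivative ?e) (at 0)"
      by (auto intro!: derivative_eq_intros)
    have ne: "p + 0 *\<^sub>R ?e \<noteq> 0" using that by simp
    have "((\<lambda>s. \<Phi> (p + s *\<^sub>R ?e)) has_real_derivative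
      A * (- ((p + 0 *\<^sub>R ?e) \<bullet> ?e / (norm (p + 0 *\<^sub>R ?e))\<^sup>2) * \<delta>
        + ((?e $ i * (p + 0 *\<^sub>R ?e) $ k + (p + 0 *\<^sub>R ?e) $ i * ?e $ k) / (norm (p + 0 *\<^sub>R ?e))\<^sup>2
           - 2 * ((p + 0 *\<^sub>R ?e) \<bullet> ?e) * (p + 0 *\<^sub>R ?e) $ i * (p + 0 *\<^sub>R ?e) $ k / norm (p + 0 *\<^sub>R ?e) ^ 4))
      + A * c * (- ((p + 0 *\<^sub>R ?e) \<bullet> ?e / (norm (p + 0 *\<^sub>R ?e))\<^sup>2) * \<delta>)) (at 0)"
      unfolding \<Phi>_def
      by (intro DERIV_add DERIV_cmult DERIV_cmult_right DERIV_minus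
          has_real_derivative_ln_norm[OF d ne] has_real_derivative_quotient_norm[OF d ne])
    moreover have "?e $ l = (if l = m then 1 else 0)" for l
      by (simp add: axis_def)
    ultimately show ?thesis
      by (simp only: inner_axis inner_real_def scaleR_zero_left add_0_right mult_1_right)
  qed
  have rearrange: "(A * X + A * c * Y) - (A * X' + A * c * Y') + A * c * J * (T - T')
     = A * X + A * c * (Y + T * J) - (A * X' + A * c * (Y' + T' * J))" for X Y T X' Y' T'
    by (simp add: algebra_simps)
  \<comment> \<open>The difference formula for \<open>KB2\<close> holds only off the segment. The
    segment is compact, so the formula persists near x and may be differentiated.\<close>
  have "\<forall>\<^sub>F s in nhds 0. x + s *\<^sub>R ?e \<notin> {y + t *\<^sub>R v | t. t \<in> {0..h}}"
  proof -
    have "compact ((\<lambda>t. y + t *\<^sub>R v) ` {0..h})"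
      by (intro compact_continuous_image continuous_intros) auto
    moreover have "(\<lambda>t. y + t *\<^sub>R v) ` {0..h} = {y + t *\<^sub>R v | t. t \<in> {0..h}}" by auto
    ultimately have "open (- {y + t *\<^sub>R v | t. t \<in> {0..h}})"
      by (metis compact_imp_closed open_Compl)
    moreover have "((\<lambda>s. x + s *\<^sub>R ?e) \<longlongrightarrow> x + 0 *\<^sub>R ?e) (nhds 0)"
      by (intro tendsto_intros filterlim_ident)
    ultimately have "\<forall>\<^sub>F s in nhds 0. x + s *\<^sub>R ?e \<in> - {y + t *\<^sub>R v | t. t \<in> {0..h}}"
      using off by (intro topological_tendstoD) auto
    then show ?thesis by simp
  qed
  then have ev: "\<forall>\<^sub>F s in nhds 0. \<Phi> (r + s *\<^sub>R ?e) - \<Phi> (r - h *\<^sub>R v + s *\<^sub>R ?e)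
       + A * c * J * (\<Theta> (r + s *\<^sub>R ?e) - \<Theta> (r - h *\<^sub>R v + s *\<^sub>R ?e))
     = KB2 lam \<mu> (x + s *\<^sub>R ?e) y v h $ i $ k"
  proof eventually_elim
    case (elim s)
    have eq: "x + s *\<^sub>R ?e - y = r + s *\<^sub>R ?e" "x + s *\<^sub>R ?e - (y + h *\<^sub>R v) = r - h *\<^sub>R v + s *\<^sub>R ?e"
      by (simp_all add: r_def)
    show ?case
      unfolding KB2_eq_diff[OF v less_imp_le[OF h] elim] vector_minus_component GB2_component eq
        A[symmetric] c[symmetric] \<Phi>_def \<Theta>_def J_def[symmetric] \<delta>_def[symmetric]
      by (rule rearrange)
  qed
  have "((\<lambda>s. \<Phi> (r + s *\<^sub>R ?e) - \<Phi> (r - h *\<^sub>R v + s *\<^sub>R ?e)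
       + A * c * J * (\<Theta> (r + s *\<^sub>R ?e) - \<Theta> (r - h *\<^sub>R v + s *\<^sub>R ?e))) has_real_derivative
     GB2_partial A c r m i k - GB2_partial A c (r - h *\<^sub>R v) m i k) (at 0)"
  proof (rule DERIV_cong[OF DERIV_add[OF DERIV_diff[OF \<Phi>[OF r0(1)] \<Phi>[OF r0(2)]]
          DERIV_cmult[OF arg2_diff_has_real_derivative[OF v h off', of m, folded \<Theta>_def]]]])
    show "A * (- (r $ m / (norm r)\<^sup>2) * \<delta>
        + (((if i = m then 1 else 0) * r $ k + r $ i * (if k = m then 1 else 0)) / (norm r)\<^sup>2
           - 2 * r $ m * r $ i * r $ k / norm r ^ 4))
      + A * c * (- (r $ m / (norm r)\<^sup>2) * \<delta>) -
     (A * (- ((r - h *\<^sub>R v) $ m / (norm (r - h *\<^sub>R v))\<^sup>2) * \<delta>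
        + (((if i = m then 1 else 0) * (r - h *\<^sub>R v) $ k + (r - h *\<^sub>R v) $ i * (if k = m then 1 else 0)) / (norm (r - h *\<^sub>R v))\<^sup>2
           - 2 * (r - h *\<^sub>R v) $ m * (r - h *\<^sub>R v) $ i * (r - h *\<^sub>R v) $ k / norm (r - h *\<^sub>R v) ^ 4))
      + A * c * (- ((r - h *\<^sub>R v) $ m / (norm (r - h *\<^sub>R v))\<^sup>2) * \<delta>))
     + A * c * J * ((if m = 1 then - (r $ 2) else r $ 1) / (norm r)\<^sup>2
     - (if m = 1 then - ((r - h *\<^sub>R v) $ 2) else (r - h *\<^sub>R v) $ 1) / (norm (r - h *\<^sub>R v))\<^sup>2)
     = GB2_partial A c r m i k - GB2_partial A c (r - h *\<^sub>R v) m i k"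
      unfolding GB2_partial_def \<delta>_def[symmetric] J_def[symmetric] by (rule rearrange)
  qed
  from DERIV_cong_nhds[OF this ev] show ?thesis
    unfolding partial_deriv_def by (simp add: DERIV_imp_deriv r_def diff_diff_eq)
qed

text \<open>The factor 2 / pi is 4 B with B = mu A = 1 / (2 pi). The Lame parameters have
  disappeared here, which is the source of the independence of alpha.\<close>

lemma stress_matrix_KB2:
  assumes adm: "admissible_lame lam \<mu>" and v: "norm v = 1" and h: "h > 0"
    and off: "x \<notin> {y + t *\<^sub>R v | t. t \<in> {0..h}}"
  shows "stress_matrix lam \<mu> (\<lambda>z. KB2 lam \<mu> z y v h) x i j k =
     - (2 / pi) * ((x - y) $ i * (x - y) $ j * (x - y) $ k / norm (x - y) ^ 4)
     + 2 / pi * ((x - (y + h *\<^sub>R v)) $ i * (x - (y + h *\<^sub>R v)) $ j * (x - (y + h *\<^sub>R v)) $ k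
         / norm (x - (y + h *\<^sub>R v)) ^ 4)"
proof -
  define A c where "A = 1 / (2 * pi * \<mu>)" and "c = (1 - lame_alpha lam \<mu>) / lame_alpha lam \<mu>"
  note pd = partial_deriv_KB2[OF v h off A_def c_def]
  have \<mu>: "\<mu> > 0" using adm by (simp add: admissible_lame_def)
  have \<alpha>: "lame_alpha lam \<mu> > 0" using adm by (simp add: admissible_lame_def)
  \<comment> \<open>Division by 0 yields 0, so positivity of alpha excludes a vanishing denominator
    as well as a vanishing numerator.\<close>
  then have "lam + 2 * \<mu> \<noteq> 0" "lam + \<mu> \<noteq> 0" by (auto simp: lame_alpha_def)
  then have c: "c * (lam + \<mu>) = \<mu>"
    unfolding c_def lame_alpha_def by (simp add: divide_simps)
  have \<mu>A: "\<mu> * A = 1 / (2 * pi)" using \<mu> by (simp add: A_def)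
  have "A * c * (lam + \<mu>) = \<mu> * A" by (simp add: mult.assoc c)
  with \<mu>A have cA: "A * c * (lam + \<mu>) = 1 / (2 * pi)" by simp
  have ne: "x - y \<noteq> 0" "x - (y + h *\<^sub>R v) \<noteq> 0"
  proof -
    have "x \<noteq> y + t *\<^sub>R v" if "t \<in> {0..h}" for t using off that by blast
    from this[of 0] this[of h] h show "x - y \<noteq> 0" "x - (y + h *\<^sub>R v) \<noteq> 0" by simp_all
  qed
  have rearrange: "lam * d * (S - S') + \<mu> * (P - P' + (Q - Q')) = lam * d * S + \<mu> * (P + Q) - (lam * d * S' + \<mu> * (P' + Q'))"
    for d S S' P P' Q Q' by (simp add: algebra_simps)
  have "stress_matrix lam \<mu> (\<lambda>z. KB2 lam \<mu> z y v h) x i j k =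
     (lam * (if i = j then 1 else 0) * (\<Sum>m\<in>UNIV. GB2_partial A c (x - y) m m k)
      + \<mu> * (GB2_partial A c (x - y) i j k + GB2_partial A c (x - y) j i k))
     - (lam * (if i = j then 1 else 0) * (\<Sum>m\<in>UNIV. GB2_partial A c (x - (y + h *\<^sub>R v)) m m k)
      + \<mu> * (GB2_partial A c (x - (y + h *\<^sub>R v)) i j k + GB2_partial A c (x - (y + h *\<^sub>R v)) j i k))"
    unfolding stress_matrix_def stress_def column_def vec_lambda_beta pd sum_subtractf by (rule rearrange)
  then show ?thesis
    unfolding GB2_partial_stress[OF \<mu>A cA ne(1)] GB2_partial_stress[OF \<mu>A cA ne(2)] by simp
qed

subsection \<open>Calculus of smooth functions\<close>

lemma frechet_derivative_cong_open:
  assumes "open S" "x \<in> S" "\<And>y. y \<in> S \<Longrightarrow> f y = g y"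
  shows "frechet_derivative f (at x) = frechet_derivative g (at x)"
    and "f differentiable (at x) \<longleftrightarrow> g differentiable (at x)"
proof -
  have "(f has_derivative D) (at x) \<longleftrightarrow> (g has_derivative D) (at x)" for D
    using has_derivative_transform_within_open[OF _ assms(1,2), of f D UNIV g]
      has_derivative_transform_within_open[OF _ assms(1,2), of g D UNIV f] assms(3) by auto
  then show "frechet_derivative f (at x) = frechet_derivative g (at x)"
    and "f differentiable (at x) \<longleftrightarrow> g differentiable (at x)"
    by (simp_all add: frechet_derivative_def differentiable_def)
qed

lemma times_cont_diff_on_cong:
  assumes "open S" "\<And>x. x \<in> S \<Longrightarrow> f x = g x" "times_cont_diff_on m S f"
  shows "times_cont_diff_on m S g"
  using assms
proof (induction m arbitrary: f g)
  case 0
  then show ?case by (simp cong: continuous_on_cong)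
next
  case (Suc m)
  have eq: "frechet_derivative f (at x) = frechet_derivative g (at x)"
      "f differentiable (at x) \<longleftrightarrow> g differentiable (at x)" if "x \<in> S" for x
    using frechet_derivative_cong_open[OF \<open>open S\<close> that] Suc.prems(2) by blast+
  moreover have "times_cont_diff_on m S (\<lambda>x. frechet_derivative g (at x) v)" for v
    by (rule Suc.IH[OF \<open>open S\<close>, of "\<lambda>x. frechet_derivative f (at x) v"]) (use eq Suc.prems(3) in auto)
  ultimately show ?case using Suc.prems(3) by simp
qed

lemma times_cont_diff_on_subset:
  "times_cont_diff_on m S f \<Longrightarrow> T \<subseteq> S \<Longrightarrow> times_cont_diff_on m T f"
  by (induction m arbitrary: f) (auto intro: continuous_on_subset)

lemma times_cont_diff_on_SucD: "times_cont_diff_on (Suc m) S f \<Longrightarrow> times_cont_diff_on m S f"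
proof (induction m arbitrary: f)
  case 0
  then show ?case
    by (simp add: continuous_at_imp_continuous_on differentiable_imp_continuous_within)
next
  case (Suc m)
  have "f differentiable (at x)" if "x \<in> S" for x
    using Suc.prems that times_cont_diff_on.simps(2)[of "Suc m" S f] by blast
  moreover have "times_cont_diff_on m S (\<lambda>x. frechet_derivative f (at x) v)" for v
    by (rule Suc.IH) (use Suc.prems times_cont_diff_on.simps(2)[of "Suc m" S f] in blast)
  ultimately show ?case by simp
qed

lemma times_cont_diff_on_imp_continuous_on: "times_cont_diff_on m S f \<Longrightarrow> continuous_on S f"
  by (induction m) (auto dest: times_cont_diff_on_SucD simp del: times_cont_diff_on.simps(2))

lemma times_cont_diff_on_const: "times_cont_diff_on m S (\<lambda>x. c)"
  by (induction m arbitrary: c) simp_all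

text \<open>An explicit derivative \<open>D\<close> may stand in for
  \<open>frechet_derivative\<close>. The closure rules below come from this and an induction over
  the order.\<close>

lemma times_cont_diff_on_SucI:
  assumes "open S"
    and deriv: "\<And>x. x \<in> S \<Longrightarrow> (f has_derivative D x) (at x)"
    and D: "\<And>v. times_cont_diff_on m S (\<lambda>x. D x v)"
  shows "times_cont_diff_on (Suc m) S f"
proof -
  have "frechet_derivative f (at x) = D x" if "x \<in> S" for x
    using frechet_derivative_at[OF deriv[OF that]] by simp
  then show ?thesis
    using deriv D times_cont_diff_on_cong[OF \<open>open S\<close>, of "\<lambda>x. D x _" "\<lambda>x. frechet_derivative f (at x) _"]
    by (auto simp: differentiable_def)
qed

lemma times_cont_diff_on_has_derivative:
  "times_cont_diff_on (Suc m) S f \<Longrightarrow> x \<in> S \<Longrightarrow> (f has_derivative frechet_derivative f (at x)) (at x)"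
  by (simp add: frechet_derivative_works)

lemma times_cont_diff_on_frechet_derivative:
  "times_cont_diff_on (Suc m) S f \<Longrightarrow> times_cont_diff_on m S (\<lambda>x. frechet_derivative f (at x) v)"
  by simp

lemma times_cont_diff_on_bounded_linear_compose:
  assumes "open S" "bounded_linear L"
  shows "times_cont_diff_on m S f \<Longrightarrow> times_cont_diff_on m S (\<lambda>x. L (f x))"
proof (induction m arbitrary: f)
  case 0
  then show ?case
    using bounded_linear.continuous_on[OF assms(2)] by simp
next
  case (Suc m)
  show ?case
    by (rule times_cont_diff_on_SucI[OF \<open>open S\<close>])
      (rule bounded_linear.has_derivative[OF assms(2) times_cont_diff_on_has_derivative[OF Suc.prems]],
       assumption, rule Suc.IH[OF times_cont_diff_on_frechet_derivative[OF Suc.prems]])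
qed

text \<open>Applied to the projections \<open>fst\<close> and \<open>snd\<close>, it turns smooth
  functions of one boundary point into smooth functions of a pair.\<close>

lemma times_cont_diff_on_compose_bounded_linear:
  assumes "open S" "bounded_linear L"
  shows "times_cont_diff_on m S f \<Longrightarrow> times_cont_diff_on m (L -` S) (\<lambda>x. f (L x))"
proof (induction m arbitrary: f)
  case 0
  then show ?case
    using continuous_on_compose2[OF _ linear_continuous_on[OF assms(2)], of S f "L -` S"] by auto
next
  case (Suc m)
  have "open (L -` S)"
    using assms by (intro open_vimage linear_continuous_on)
  show ?case
  proof (rule times_cont_diff_on_SucI[OF \<open>open (L -` S)\<close>])
    fix x assume "x \<in> L -` S"
    then show "((\<lambda>x. f (L x)) has_derivative (\<lambda>v. frechet_derivative f (at (L x)) (L v))) (at x)"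
      by (intro has_derivative_compose[OF bounded_linear_imp_has_derivative[OF assms(2)]]
        times_cont_diff_on_has_derivative[OF Suc.prems]) simp
  qed (rule Suc.IH[OF times_cont_diff_on_frechet_derivative[OF Suc.prems]])
qed

lemma times_cont_diff_on_add:
  assumes "open S"
  shows "times_cont_diff_on m S f \<Longrightarrow> times_cont_diff_on m S g \<Longrightarrow> times_cont_diff_on m S (\<lambda>x. f x + g x)"
proof (induction m arbitrary: f g)
  case 0
  then show ?case by (auto intro: continuous_on_add)
next
  case (Suc m)
  show ?case
    by (rule times_cont_diff_on_SucI[OF \<open>open S\<close>])
      (rule has_derivative_add[OF times_cont_diff_on_has_derivative[OF Suc.prems(1)]
          times_cont_diff_on_has_derivative[OF Suc.prems(2)]], assumption, assumption,
       rule Suc.IH[OF times_cont_diff_on_frechet_derivative[OF Suc.prems(1)]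
          times_cont_diff_on_frechet_derivative[OF Suc.prems(2)]])
qed

lemma times_cont_diff_on_scaleR:
  assumes "open S"
  shows "times_cont_diff_on m S f \<Longrightarrow> times_cont_diff_on m S g \<Longrightarrow> times_cont_diff_on m S (\<lambda>x. f x *\<^sub>R g x)"
proof (induction m arbitrary: f g)
  case 0
  then show ?case by (auto intro: continuous_on_scaleR)
next
  case (Suc m)
  show ?case
    by (rule times_cont_diff_on_SucI[OF \<open>open S\<close>])
      (rule has_derivative_scaleR[OF times_cont_diff_on_has_derivative[OF Suc.prems(1)]
          times_cont_diff_on_has_derivative[OF Suc.prems(2)]], assumption, assumption,
       \<comment> \<open>The product rule contains the undifferentiated factors, which are needed
         one order lower; \<open>times_cont_diff_on_SucD\<close> lowers it.\<close>
       intro times_cont_diff_on_add[OF \<open>open S\<close>] Suc.IH times_cont_diff_on_frechet_derivative[OF Suc.prems(1)]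
          times_cont_diff_on_frechet_derivative[OF Suc.prems(2)]
          times_cont_diff_on_SucD[OF Suc.prems(1)] times_cont_diff_on_SucD[OF Suc.prems(2)])
qed

lemma times_cont_diff_on_mult:
  fixes f g :: "'a::euclidean_space \<Rightarrow> real"
  assumes "open S" "times_cont_diff_on m S f" "times_cont_diff_on m S g"
  shows "times_cont_diff_on m S (\<lambda>x. f x * g x)"
  using times_cont_diff_on_scaleR[OF assms] by simp

text \<open>The derivative of \<open>1 / sqrt f\<close> is a polynomial in the function itself and the derivative of \<open>f\<close>,
  so the induction closes; other negative powers are obtained by multiplication.\<close>

lemma times_cont_diff_on_inverse_sqrt:
  assumes "open S" "\<And>x. x \<in> S \<Longrightarrow> f x > 0"
  shows "times_cont_diff_on m S f \<Longrightarrow> times_cont_diff_on m S (\<lambda>x. inverse (sqrt (f x)))"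
proof (induction m)
  case 0
  then show ?case using assms(2) by (auto intro!: continuous_intros simp: less_imp_neq[THEN not_sym])
next
  case (Suc m)
  let ?q = "\<lambda>x. inverse (sqrt (f x))"
  have q: "times_cont_diff_on m S ?q"
    by (rule Suc.IH[OF times_cont_diff_on_SucD[OF Suc.prems]])
  show ?case
  proof (rule times_cont_diff_on_SucI[OF \<open>open S\<close>])
    fix x assume x: "x \<in> S"
    have "((\<lambda>t. inverse (sqrt t)) has_real_derivative - (1/2) * (?q x * ?q x * ?q x)) (at (f x))"
      using assms(2)[OF x] by (auto intro!: derivative_eq_intros simp: field_simps power2_eq_square)
    from has_derivative_compose[OF times_cont_diff_on_has_derivative[OF Suc.prems x]
        has_field_derivative_imp_has_derivative[OF this]]
    show "(?q has_derivative (\<lambda>v. - (1/2) * (?q x * ?q x * ?q x) * frechet_derivative f (at x) v)) (at x)" .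
  next
    show "times_cont_diff_on m S (\<lambda>x. - (1/2) * (?q x * ?q x * ?q x) * frechet_derivative f (at x) v)" for v
      by (intro times_cont_diff_on_mult \<open>open S\<close> times_cont_diff_on_const q
        times_cont_diff_on_frechet_derivative[OF Suc.prems])
  qed
qed

lemma times_cont_diff_on_sum:
  assumes "open S" "\<And>i. i \<in> I \<Longrightarrow> times_cont_diff_on m S (f i)"
  shows "times_cont_diff_on m S (\<lambda>x. \<Sum>i\<in>I. f i x)"
  using assms(2)
  by (induction I rule: infinite_finite_induct)
    (simp_all add: times_cont_diff_on_const times_cont_diff_on_add[OF \<open>open S\<close>])

lemma times_cont_diff_on_inner:
  fixes f g :: "'a::euclidean_space \<Rightarrow> 'b::euclidean_space"
  assumes "open S" "times_cont_diff_on m S f" "times_cont_diff_on m S g"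
  shows "times_cont_diff_on m S (\<lambda>x. f x \<bullet> g x)"
proof -
  have "times_cont_diff_on m S (\<lambda>x. \<Sum>b\<in>Basis. (f x \<bullet> b) * (g x \<bullet> b))"
    using assms by (intro times_cont_diff_on_sum times_cont_diff_on_mult
        times_cont_diff_on_bounded_linear_compose[OF _ bounded_linear_inner_left])
  then show ?thesis by (simp flip: euclidean_inner)
qed

lemma smooth_along_imp_continuous_on:
  assumes "smooth_along S f"
  shows "continuous_on S f"
  unfolding continuous_on_eq_continuous_within
proof
  fix p assume p: "p \<in> S"
  with assms obtain U g where U: "open U" "p \<in> U" "smooth_on_open U g" "\<forall>x\<in>S \<inter> U. f x = g x"
    unfolding smooth_along_def by metis
  have "continuous_on U g"
    using U(3) times_cont_diff_on_imp_continuous_on unfolding smooth_on_open_def by blast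
  then have "continuous (at p within S) g"
    using U(1,2) by (simp add: continuous_on_eq_continuous_at continuous_at_imp_continuous_at_within)
  moreover have "\<forall>\<^sub>F x in at p within S. g x = f x"
    using U p unfolding eventually_at_topological by (intro exI[of _ U]) auto
  moreover have "g p = f p" using U p by simp
  ultimately show "continuous (at p within S) f"
    unfolding continuous_within by (metis Lim_transform_eventually)
qed

subsection \<open>Outer normal and cone condition\<close>

text \<open>Built from values of \<open>frechet_derivative\<close>, so that its smoothness can be
  read off \<open>smooth_on_open\<close>. It represents the derivative only at points of
  differentiability.\<close>

definition grad :: "(real^2 \<Rightarrow> real) \<Rightarrow> real^2 \<Rightarrow> real^2"
  where "grad \<phi> x = (\<chi> i. frechet_derivative \<phi> (at x) (axis i 1))"

lemma grad_inner:
  assumes "\<phi> differentiable (at x)"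
  shows "frechet_derivative \<phi> (at x) = (\<lambda>v. grad \<phi> x \<bullet> v)"
proof
  fix v
  let ?D = "frechet_derivative \<phi> (at x)"
  have "linear ?D"
    using assms by (rule linear_frechet_derivative)
  have "?D v = ?D (\<Sum>i\<in>UNIV. v $ i *\<^sub>R axis i 1)"
    using basis_expansion[of v] by (simp add: scalar_mult_eq_scaleR)
  also have "\<dots> = grad \<phi> x \<bullet> v"
    by (simp add: linear_sum[OF \<open>linear ?D\<close>] linear_cmul[OF \<open>linear ?D\<close>] grad_def inner_vec_def mult.commute)
  finally show "?D v = grad \<phi> x \<bullet> v" .
qed

lemma has_derivative_grad:
  "\<phi> differentiable (at x) \<Longrightarrow> (\<phi> has_derivative (\<lambda>v. grad \<phi> x \<bullet> v)) (at x)"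
  using grad_inner frechet_derivative_works by metis

lemma GDERIV_iff_grad: "GDERIV \<phi> x :> g \<longleftrightarrow> \<phi> differentiable (at x) \<and> g = grad \<phi> x"
proof
  assume "GDERIV \<phi> x :> g"
  then have d: "(\<phi> has_derivative (\<lambda>v. v \<bullet> g)) (at x)"
    by (simp add: gderiv_def)
  then have diff: "\<phi> differentiable (at x)" by (rule differentiableI)
  have "(\<lambda>v. v \<bullet> g) = (\<lambda>v. grad \<phi> x \<bullet> v)"
    by (rule has_derivative_unique[OF d has_derivative_grad[OF diff]])
  then have "g \<bullet> v = grad \<phi> x \<bullet> v" for v
    by (metis inner_commute)
  with diff show "\<phi> differentiable (at x) \<and> g = grad \<phi> x"
    by (metis vector_eq_rdot)
next
  assume "\<phi> differentiable (at x) \<and> g = grad \<phi> x"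
  then show "GDERIV \<phi> x :> g"
    using has_derivative_grad by (simp add: gderiv_def inner_commute)
qed

lemma smooth_on_open_differentiable: "smooth_on_open U f \<Longrightarrow> x \<in> U \<Longrightarrow> f differentiable (at x)"
  unfolding smooth_on_open_def by (metis times_cont_diff_on.simps(2))

lemma smooth_on_open_frechet_derivative:
  "smooth_on_open U f \<Longrightarrow> smooth_on_open U (\<lambda>x. frechet_derivative f (at x) v)"
  unfolding smooth_on_open_def by (metis times_cont_diff_on.simps(2))

lemma smooth_on_open_imp_continuous_on: "smooth_on_open U f \<Longrightarrow> continuous_on U f"
  unfolding smooth_on_open_def using times_cont_diff_on.simps(1) by blast

lemma continuous_on_grad: "smooth_on_open U \<phi> \<Longrightarrow> continuous_on U (grad \<phi>)"
  unfolding grad_def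
  by (intro continuous_on_vec_lambda smooth_on_open_imp_continuous_on smooth_on_open_frechet_derivative)

lemma local_defining_functionD:
  assumes "local_defining_function \<Omega> p U \<phi>"
  shows "open U" "p \<in> U" "smooth_on_open U \<phi>"
    and "x \<in> U \<Longrightarrow> \<phi> differentiable (at x)" "x \<in> U \<Longrightarrow> grad \<phi> x \<noteq> 0"
    and "x \<in> U \<Longrightarrow> x \<in> \<Omega> \<longleftrightarrow> \<phi> x < 0" "x \<in> U \<Longrightarrow> x \<in> frontier \<Omega> \<longleftrightarrow> \<phi> x = 0"
proof -
  show U: "open U" "p \<in> U" "smooth_on_open U \<phi>"
    using assms by (auto simp: local_defining_function_def)
  show diff: "\<phi> differentiable (at x)" if "x \<in> U"
    using smooth_on_open_differentiable U that by blast
  show "grad \<phi> x \<noteq> 0" if x: "x \<in> U"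
  proof
    assume "grad \<phi> x = 0"
    with grad_inner[OF diff[OF x]] have "frechet_derivative \<phi> (at x) = (\<lambda>_. 0)" by simp
    with assms x show False by (simp add: local_defining_function_def)
  qed
  show "x \<in> \<Omega> \<longleftrightarrow> \<phi> x < 0" "x \<in> frontier \<Omega> \<longleftrightarrow> \<phi> x = 0" if "x \<in> U"
    using assms that unfolding local_defining_function_def by blast+
qed

lemma local_defining_function_move:
  "local_defining_function \<Omega> p U \<phi> \<Longrightarrow> q \<in> U \<Longrightarrow> local_defining_function \<Omega> q U \<phi>"
  by (simp add: local_defining_function_def)

lemma has_real_derivative_along_line:
  assumes "\<phi> differentiable (at p)"
  shows "((\<lambda>t. \<phi> (p + t *\<^sub>R d)) has_real_derivative grad \<phi> p \<bullet> d) (at 0)"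
proof -
  have "((\<lambda>t. p + t *\<^sub>R d) has_derivative (\<lambda>t. t *\<^sub>R d)) (at 0)"
    by (auto intro!: derivative_eq_intros)
  from has_derivative_compose[OF this, of \<phi> "\<lambda>v. grad \<phi> p \<bullet> v"] has_derivative_grad[OF assms]
  show ?thesis by (simp add: has_field_derivative_def mult_commute_abs)
qed

text \<open>If the unit gradients a and b of two defining functions differed, a small step from p
  along b - a would decrease \<phi> and increase \<psi>. The point reached would be inside \<Omega>
  by \<phi> and outside by \<psi>.\<close>

lemma sgn_grad_unique:
  assumes 1: "local_defining_function \<Omega> p U \<phi>" and 2: "local_defining_function \<Omega> p V \<psi>"
    and p: "p \<in> frontier \<Omega>"
  shows "sgn (grad \<phi> p) = sgn (grad \<psi> p)"
proof (rule ccontr)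
  note D1 = local_defining_functionD[OF 1] and D2 = local_defining_functionD[OF 2]
  define a b where "a = sgn (grad \<phi> p)" and "b = sgn (grad \<psi> p)"
  assume "sgn (grad \<phi> p) \<noteq> sgn (grad \<psi> p)"
  then have "(a - b) \<bullet> (a - b) > 0" by (simp add: a_def b_def)
  have ab: "a \<bullet> a = 1" "b \<bullet> b = 1"
    using D1(2,5) D2(2,5) by (auto simp: a_def b_def norm_sgn simp flip: norm_eq_1)
  have lt: "a \<bullet> b < 1"
    using \<open>(a - b) \<bullet> (a - b) > 0\<close> ab by (simp add: inner_diff_left inner_diff_right inner_commute)
  have ga: "grad \<phi> p = norm (grad \<phi> p) *\<^sub>R a" "grad \<psi> p = norm (grad \<psi> p) *\<^sub>R b"
    using D1(2,5) D2(2,5) by (auto simp: a_def b_def sgn_div_norm)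
  have "a \<bullet> (b - a) < 0" "b \<bullet> (b - a) > 0"
    using lt ab by (simp_all add: inner_diff_right inner_commute)
  then have neg: "grad \<phi> p \<bullet> (b - a) < 0" and pos: "grad \<psi> p \<bullet> (b - a) > 0"
    using D1(2,5) D2(2,5) by (subst ga, simp add: mult_less_0_iff zero_less_mult_iff)+
  obtain d1 where d1: "d1 > 0" "\<And>h. 0 < h \<Longrightarrow> h < d1 \<Longrightarrow> \<phi> (p + h *\<^sub>R (b - a)) < \<phi> p"
    using DERIV_neg_dec_right[OF has_real_derivative_along_line[OF D1(4)[OF D1(2)]] neg] by auto
  obtain d2 where d2: "d2 > 0" "\<And>h. 0 < h \<Longrightarrow> h < d2 \<Longrightarrow> \<psi> (p + h *\<^sub>R (b - a)) > \<psi> p"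
    using DERIV_pos_inc_right[OF has_real_derivative_along_line[OF D2(4)[OF D2(2)]] pos] by auto
  have "((\<lambda>h. p + h *\<^sub>R (b - a)) \<longlongrightarrow> p + 0 *\<^sub>R (b - a)) (at_right 0)"
    by (intro tendsto_intros)
  then have "\<forall>\<^sub>F h in at_right 0. p + h *\<^sub>R (b - a) \<in> U \<inter> V"
    using D1(1,2) D2(1,2) by (intro topological_tendstoD) auto
  moreover have "\<forall>\<^sub>F h in at_right 0. h \<in> {0<..<min d1 d2}"
    using d1(1) d2(1) by (intro eventually_at_right_real) auto
  ultimately have "\<forall>\<^sub>F h in at_right (0::real). False"
  proof eventually_elim
    case (elim h)
    let ?q = "p + h *\<^sub>R (b - a)"
    have "\<phi> p = 0" "\<psi> p = 0" using D1(2,7) D2(2,7) p by auto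
    with elim d1(2)[of h] d2(2)[of h] have "\<phi> ?q < 0" "\<psi> ?q > 0" by auto
    then show ?case
      using elim D1(6)[of ?q] D2(6)[of ?q] by auto
  qed
  then show False by simp
qed

lemma outer_normal_eq:
  assumes "local_defining_function \<Omega> p U \<phi>" and p: "p \<in> frontier \<Omega>"
  shows "outer_normal \<Omega> p = sgn (grad \<phi> p)"
  unfolding outer_normal_def
proof (rule the_equality)
  show "\<exists>U \<phi>' g. local_defining_function \<Omega> p U \<phi>' \<and> GDERIV \<phi>' p :> g \<and> sgn (grad \<phi> p) = sgn g"
    using assms local_defining_functionD(2,4)[OF assms(1)] unfolding GDERIV_iff_grad by blast
next
  fix \<nu> assume "\<exists>U \<phi> g. local_defining_function \<Omega> p U \<phi> \<and> GDERIV \<phi> p :> g \<and> \<nu> = sgn g"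
  then show "\<nu> = sgn (grad \<phi> p)"
    using sgn_grad_unique[OF _ assms] unfolding GDERIV_iff_grad by blast
qed

lemma norm_outer_normal:
  assumes "smooth_domain \<Omega>" "p \<in> frontier \<Omega>"
  shows "norm (outer_normal \<Omega> p) = 1"
proof -
  obtain U \<phi> where "local_defining_function \<Omega> p U \<phi>"
    using assms unfolding smooth_domain_def by blast
  with assms show ?thesis
    by (metis outer_normal_eq local_defining_functionD(2,5) norm_sgn)
qed

lemma mvt_segment:
  fixes \<phi> :: "'a::real_inner \<Rightarrow> real"
  assumes S: "convex S" "x \<in> S" "y \<in> S" and d: "\<And>z. z \<in> S \<Longrightarrow> (\<phi> has_derivative (\<lambda>v. G z \<bullet> v)) (at z)"
  obtains z where "z \<in> closed_segment x y" "\<phi> y - \<phi> x = G z \<bullet> (y - x)"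
proof -
  have "\<exists>t\<in>{0..1}. \<phi> (x + 1 *\<^sub>R (y - x)) - \<phi> (x + 0 *\<^sub>R (y - x)) = G (x + t *\<^sub>R (y - x)) \<bullet> ((1 - 0) *\<^sub>R (y - x))"
  proof (rule mvt_very_simple[where f = "\<lambda>t. \<phi> (x + t *\<^sub>R (y - x))" and f' = "\<lambda>t s. G (x + t *\<^sub>R (y - x)) \<bullet> (s *\<^sub>R (y - x))"])
    fix t :: real assume "0 \<le> t" "t \<le> 1"
    then have "x + t *\<^sub>R (y - x) \<in> S"
      using convexD_alt[OF S, of t] by (simp add: algebra_simps)
    moreover have "((\<lambda>t. x + t *\<^sub>R (y - x)) has_derivative (\<lambda>s. s *\<^sub>R (y - x))) (at t within {0..1})"
      by (auto intro!: derivative_eq_intros)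
    ultimately show "((\<lambda>t. \<phi> (x + t *\<^sub>R (y - x))) has_derivative (\<lambda>s. G (x + t *\<^sub>R (y - x)) \<bullet> (s *\<^sub>R (y - x)))) (at t within {0..1})"
      using d by (intro has_derivative_compose[of "\<lambda>t. x + t *\<^sub>R (y - x)" _ _ _ \<phi>])
  qed simp
  then obtain t where t: "0 \<le> t" "t \<le> 1" "\<phi> y - \<phi> x = G (x + t *\<^sub>R (y - x)) \<bullet> (y - x)" by auto
  have "x + t *\<^sub>R (y - x) \<in> closed_segment x y"
    using t by (auto simp: in_segment algebra_simps intro!: exI[of _ t])
  with t(3) that show ?thesis by blast
qed

text \<open>It makes the projection to the tangent bi-Lipschitz on small pieces of the boundary, so that their
  length can be bounded without parametrising them.\<close>

lemma frontier_cone_condition: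
  assumes dom: "smooth_domain \<Omega>" and p: "p \<in> frontier \<Omega>"
  obtains r where "r > 0" "\<And>x y. x \<in> frontier \<Omega> \<inter> ball p r \<Longrightarrow> y \<in> frontier \<Omega> \<inter> ball p r \<Longrightarrow>
    norm (x - y) \<le> 2 * \<bar>perp (outer_normal \<Omega> p) \<bullet> (x - y)\<bar>"
proof -
  obtain U \<phi> where ldf: "local_defining_function \<Omega> p U \<phi>"
    using dom p unfolding smooth_domain_def by blast
  note D = local_defining_functionD[OF ldf]
  define g where "g = grad \<phi> p"
  have g: "norm g > 0" using D(2,5) by (simp add: g_def)
  have n: "outer_normal \<Omega> p = sgn g" using outer_normal_eq[OF ldf p] by (simp add: g_def)
  have "isCont (grad \<phi>) p"
    using continuous_on_grad[OF D(3)] D(1,2) by (simp add: continuous_on_eq_continuous_at)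
  \<comment> \<open>Half the gradient is the tolerance: then at most half of a chord is normal, its
    tangential part is at least sqrt 3 / 2 of its length by Pythagoras, and the constant 2
    suffices.\<close>
  then obtain s where s: "s > 0" "\<And>x. dist x p < s \<Longrightarrow> dist (grad \<phi> x) g < norm g / 2"
    unfolding continuous_at_eps_delta g_def[symmetric] using g by (metis half_gt_zero)
  obtain s' where s': "s' > 0" "ball p s' \<subseteq> U"
    using D(1,2) open_contains_ball by blast
  show ?thesis
  proof (rule that[of "min s s'"])
    show "min s s' > 0" using s s' by simp
    fix x y assume x: "x \<in> frontier \<Omega> \<inter> ball p (min s s')" and y: "y \<in> frontier \<Omega> \<inter> ball p (min s s')"
    have zero: "\<phi> x = 0" "\<phi> y = 0" using x y s' D(7) by auto
    obtain z where z: "z \<in> closed_segment y x" "\<phi> x - \<phi> y = grad \<phi> z \<bullet> (x - y)"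
    proof (rule mvt_segment[of "ball p (min s s')" y x \<phi> "grad \<phi>"])
      show "(\<phi> has_derivative (\<lambda>v. grad \<phi> z \<bullet> v)) (at z)" if "z \<in> ball p (min s s')" for z
        using that s'(2) by (intro has_derivative_grad D(4)) auto
    qed (use x y in auto)
    have "z \<in> ball p (min s s')"
      using z(1) x y closed_segment_subset[OF _ _ convex_ball] by blast
    then have "norm (grad \<phi> z - g) \<le> norm g / 2"
      using s(2)[of z] by (simp add: dist_norm dist_commute norm_minus_commute)
    have "g \<bullet> (x - y) = (g - grad \<phi> z) \<bullet> (x - y)"
      using z zero by (simp add: inner_diff_left)
    then have "\<bar>g \<bullet> (x - y)\<bar> \<le> norm g / 2 * norm (x - y)"
      using Cauchy_Schwarz_ineq2[of "g - grad \<phi> z" "x - y"] \<open>norm (grad \<phi> z - g) \<le> norm g / 2\<close>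
        mult_right_mono[of "norm (g - grad \<phi> z)" "norm g / 2" "norm (x - y)"]
      by (simp add: norm_minus_commute)
    then have "\<bar>sgn g \<bullet> (x - y)\<bar> \<le> norm (x - y) / 2"
      using g by (simp add: sgn_div_norm abs_mult field_simps)
    then have "(sgn g \<bullet> (x - y))\<^sup>2 \<le> (norm (x - y) / 2)\<^sup>2"
      by (metis abs_le_square_iff abs_norm_cancel abs_of_nonneg abs_divide abs_numeral)
    moreover have "norm (sgn g) = 1" using g by (simp add: norm_sgn)
    ultimately have "(norm (x - y))\<^sup>2 \<le> (2 * (perp (sgn g) \<bullet> (x - y)))\<^sup>2"
      using inner_sq_plus_perp_inner_sq[of "sgn g" "x - y"] 
      by (simp add: power2_eq_square)  (smt (verit) mult_nonneg_nonneg norm_ge_zero)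
    then have "\<bar>norm (x - y)\<bar> \<le> \<bar>2 * (perp (sgn g) \<bullet> (x - y))\<bar>"
      by (rule iffD2[OF abs_le_square_iff])
    then show "norm (x - y) \<le> 2 * \<bar>perp (outer_normal \<Omega> p) \<bullet> (x - y)\<bar>"
      by (simp add: n abs_mult)
  qed
qed

subsection \<open>Arc length is finite\<close>

text \<open>The projection lies in an interval of length 2 R. Cutting it into N slabs of width w = 2
  R / N cuts A into pieces of diameter at most K w; N is taken so large that K w is at most
  \<delta>, and the total N K w = 2 R K does not depend on \<delta>.\<close>

lemma hausdorff1_outer_le_of_projection:
  fixes u :: "real^2"
  assumes A: "bounded A" and K: "K > 0" and R: "R > 0"
    and lip: "\<And>x y. x \<in> A \<Longrightarrow> y \<in> A \<Longrightarrow> norm (x - y) \<le> K * \<bar>u \<bullet> (x - y)\<bar>"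
    and proj: "\<And>x. x \<in> A \<Longrightarrow> \<bar>u \<bullet> x - c\<bar> < R"
  shows "hausdorff1_outer A \<le> ennreal (2 * R * K)"
  unfolding hausdorff1_outer_def
proof (rule SUP_least)
  fix \<delta> :: real assume "\<delta> \<in> {0<..}"
  then have "\<delta> > 0" by simp
  obtain N :: nat where N: "2 * R * K / \<delta> < real N" using reals_Archimedean2 by blast
  have "2 * R * K / \<delta> > 0" using R K \<open>\<delta> > 0\<close> by simp
  with N have "real N > 0" by linarith
  define w where "w = 2 * R / real N"
  have w: "w > 0" using R \<open>real N > 0\<close> by (simp add: w_def)
  have Kw: "K * w \<le> \<delta>"
    using N \<open>\<delta> > 0\<close> \<open>real N > 0\<close> by (simp add: w_def field_simps)
  \<comment> \<open>Covers are infinite sequences, so the N slabs are padded with empty sets, whose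
    diameter is 0. Neighbouring slabs share their end values, which a cover permits.\<close>
  define C where "C n = (if n < N then {x \<in> A. c - R + real n * w \<le> u \<bullet> x \<and> u \<bullet> x \<le> c - R + (real n + 1) * w} else {})" for n
  have diam: "diameter (C n) \<le> K * w" for n
  proof (rule diameter_le)
    show "C n \<noteq> {} \<or> 0 \<le> K * w" using K w by simp
    fix x y assume xy: "x \<in> C n" "y \<in> C n"
    then have "x \<in> A" "y \<in> A" "\<bar>u \<bullet> (x - y)\<bar> \<le> w"
      by (auto simp: C_def inner_diff_right distrib_right abs_le_iff split: if_splits)
    then show "norm (x - y) \<le> K * w"
      using lip[of x y] mult_left_mono[of "\<bar>u \<bullet> (x - y)\<bar>" w K] K by linarith
  qed
  have cover: "A \<subseteq> (\<Union>n. C n)"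
  proof
    fix x assume x: "x \<in> A"
    define s where "s = (u \<bullet> x - (c - R)) / w"
    define n where "n = nat \<lfloor>s\<rfloor>"
    have "s \<ge> 0" using proj[OF x] w by (simp add: s_def abs_less_iff)
    have "s < real N"
    proof -
      have "u \<bullet> x - (c - R) < 2 * R" using proj[OF x] by (auto simp: abs_less_iff)
      also have "2 * R = real N * w" using \<open>real N > 0\<close> by (simp add: w_def)
      finally show ?thesis using w by (simp add: s_def pos_divide_less_eq)
    qed
    have n: "real n \<le> s" "s < real n + 1"
      using \<open>s \<ge> 0\<close> by (simp_all add: n_def)
    then have "n < N" using \<open>s < real N\<close> by linarith
    have sw: "s * w = u \<bullet> x - (c - R)" using w by (simp add: s_def)
    have "real n * w \<le> s * w" "s * w \<le> (real n + 1) * w"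
      using n w by (intro mult_right_mono; simp)+
    then show "x \<in> (\<Union>n. C n)"
      using x \<open>n < N\<close> sw by (intro UN_I[of n]) (auto simp: C_def)
  qed
  have "hausdorff1_delta \<delta> A \<le> (\<Sum>n. ennreal (diameter (C n)))"
    unfolding hausdorff1_delta_def
  proof (rule INF_lower, intro CollectI conjI allI cover)
    fix n
    show "bounded (C n)" using A by (rule bounded_subset) (auto simp: C_def split: if_splits)
    show "diameter (C n) \<le> \<delta>" using diam[of n] Kw by linarith
  qed
  also have "\<dots> = (\<Sum>n<N. ennreal (diameter (C n)))"
    by (rule suminf_finite) (auto simp: C_def)
  also have "\<dots> \<le> (\<Sum>n<N. ennreal (K * w))"
    by (intro sum_mono ennreal_leI diam)
  also have "\<dots> = ennreal (real N * (K * w))"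
    using K w by (simp add: ennreal_mult ennreal_of_nat_eq_real_of_nat)
  also have "real N * (K * w) = 2 * R * K"
    using \<open>real N > 0\<close> by (simp add: w_def)
  finally show "hausdorff1_delta \<delta> A \<le> ennreal (2 * R * K)" .
qed

lemma hausdorff1_outer_singleton: "hausdorff1_outer {x} = 0"
proof -
  have "hausdorff1_delta \<delta> {x} \<le> 0" if "\<delta> > 0" for \<delta>
  proof -
    have "hausdorff1_delta \<delta> {x} \<le> (\<Sum>n. ennreal (diameter ((\<lambda>n. {x}) (n::nat))))"
      unfolding hausdorff1_delta_def using that by (intro INF_lower) auto
    then show ?thesis by simp
  qed
  then show ?thesis
    unfolding hausdorff1_outer_def by (auto intro!: antisym SUP_least)
qed

lemma sets_arc_length [simp]: "sets (arc_length \<Omega>) = sets (restrict_space borel (frontier \<Omega>))"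
  unfolding arc_length_def
  by (intro sets_restrict_space_cong) (simp add: sets_measure_of_conv sets.sigma_sets_eq[of borel, simplified])

lemma space_arc_length [simp]: "space (arc_length \<Omega>) = frontier \<Omega>"
  by (simp add: arc_length_def space_restrict_space space_measure_of_conv)

text \<open>\<^const>\<open>measure_of\<close> returns either the given set function or the zero measure, so this
  inequality needs no countable additivity of the Hausdorff measure.\<close>

lemma emeasure_arc_length_le:
  assumes "X \<in> sets borel" "X \<subseteq> frontier \<Omega>"
  shows "emeasure (arc_length \<Omega>) X \<le> hausdorff1_outer X"
proof -
  have "emeasure (arc_length \<Omega>) X = emeasure (measure_of UNIV (sets borel) hausdorff1_outer) X"
    unfolding arc_length_def
    using assms by (intro emeasure_restrict_space)
      (auto simp: sets_measure_of_conv sets.sigma_sets_eq[of borel, simplified])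
  also have "\<dots> \<le> hausdorff1_outer X"
    by (simp add: emeasure_measure_of_conv)
  finally show ?thesis .
qed

text \<open>The cone condition makes each short piece of the boundary finite in length, and
  compactness leaves finitely many pieces.\<close>

lemma finite_measure_arc_length:
  assumes dom: "smooth_domain \<Omega>"
  shows "finite_measure (arc_length \<Omega>)"
proof (rule finite_measureI)
  have "\<forall>p\<in>frontier \<Omega>. \<exists>r>0. emeasure (arc_length \<Omega>) (frontier \<Omega> \<inter> ball p r) < \<infinity>"
  proof
    fix p assume p: "p \<in> frontier \<Omega>"
    obtain r where r: "r > 0" and cone: "\<And>x y. x \<in> frontier \<Omega> \<inter> ball p r \<Longrightarrow> y \<in> frontier \<Omega> \<inter> ball p r \<Longrightarrow>
        norm (x - y) \<le> 2 * \<bar>perp (outer_normal \<Omega> p) \<bullet> (x - y)\<bar>"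
      using frontier_cone_condition[OF dom p] by blast
    define u where "u = perp (outer_normal \<Omega> p)"
    \<comment> \<open>The summand 1 makes the bound on the projection strict and the radius positive
      without computing the norm of u.\<close>
    have pos: "(norm u + 1) * r > 0" using r by (intro mult_pos_pos add_nonneg_pos) auto
    have "hausdorff1_outer (frontier \<Omega> \<inter> ball p r) \<le> ennreal (2 * ((norm u + 1) * r) * 2)"
    proof (rule hausdorff1_outer_le_of_projection[where c = "u \<bullet> p"])
      fix x assume x: "x \<in> frontier \<Omega> \<inter> ball p r"
      have "\<bar>u \<bullet> x - u \<bullet> p\<bar> \<le> norm u * norm (x - p)"
        using Cauchy_Schwarz_ineq2[of u "x - p"] by (simp add: inner_diff_right)
      also have "\<dots> \<le> norm u * r"
        using x by (intro mult_left_mono) (auto simp: dist_norm norm_minus_commute)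
      also have "\<dots> < (norm u + 1) * r" using r by (simp add: distrib_right)
      finally show "\<bar>u \<bullet> x - u \<bullet> p\<bar> < (norm u + 1) * r" .
    qed (use r cone pos in \<open>auto simp: u_def intro: bounded_Int\<close>)
    moreover have "emeasure (arc_length \<Omega>) (frontier \<Omega> \<inter> ball p r) \<le> hausdorff1_outer (frontier \<Omega> \<inter> ball p r)"
      by (intro emeasure_arc_length_le) (auto intro!: sets.Int borel_closed)
    ultimately show "\<exists>r>0. emeasure (arc_length \<Omega>) (frontier \<Omega> \<inter> ball p r) < \<infinity>"
      using r by (intro exI[of _ r]) (auto simp: le_less_trans)
  qed
  then obtain r where r: "\<And>p. p \<in> frontier \<Omega> \<Longrightarrow> r p > 0"
    and fin: "\<And>p. p \<in> frontier \<Omega> \<Longrightarrow> emeasure (arc_length \<Omega>) (frontier \<Omega> \<inter> ball p (r p)) < \<infinity>"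
    by metis
  have "compact (frontier \<Omega>)" using dom by (simp add: smooth_domain_def)
  then obtain T where T: "T \<subseteq> frontier \<Omega>" "finite T" "frontier \<Omega> \<subseteq> (\<Union>p\<in>T. ball p (r p))"
  proof (rule compactE_image[of "frontier \<Omega>" "frontier \<Omega>" "\<lambda>p. ball p (r p)"])
    show "frontier \<Omega> \<subseteq> (\<Union>p\<in>frontier \<Omega>. ball p (r p))" using r by force
  qed auto
  have meas: "frontier \<Omega> \<inter> ball p (r p) \<in> sets (arc_length \<Omega>)" for p
    by (simp add: sets_restrict_space)
  have "emeasure (arc_length \<Omega>) (frontier \<Omega>) \<le> emeasure (arc_length \<Omega>) (\<Union>p\<in>T. frontier \<Omega> \<inter> ball p (r p))"
    using T meas by (intro emeasure_mono sets.finite_UN) auto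
  also have "\<dots> \<le> (\<Sum>p\<in>T. emeasure (arc_length \<Omega>) (frontier \<Omega> \<inter> ball p (r p)))"
    using T(2) meas by (intro emeasure_subadditive_finite) auto
  also have "\<dots> < \<infinity>"
    using T fin by (simp add: ennreal_sum_less_top subset_iff)
  finally show "emeasure (arc_length \<Omega>) (space (arc_length \<Omega>)) \<noteq> \<infinity>" by simp
qed

text \<open>It disposes of the diagonal, where \<open>SigmaB2\<close> carries no
  information.\<close>

lemma AE_arc_length_neq:
  assumes "x \<in> frontier \<Omega>"
  shows "AE y in arc_length \<Omega>. y \<noteq> x"
proof (rule AE_I')
  have "emeasure (arc_length \<Omega>) {x} \<le> 0"
    using emeasure_arc_length_le[of "{x}" \<Omega>] assms by (simp add: hausdorff1_outer_singleton)
  moreover have "{x} \<in> sets (arc_length \<Omega>)"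
    using assms by (auto simp: sets_restrict_space intro!: image_eqI[of _ _ "{x}"])
  ultimately show "{x} \<in> null_sets (arc_length \<Omega>)" by auto
qed auto

subsection \<open>Near and far kernels\<close>

lemma traction_kernel_eq: "traction_kernel \<nu> r i k = (\<nu> \<bullet> r) * (r $ i * r $ k) / norm r ^ 4"
  unfolding traction_kernel_def inner_vec_def inner_real_def sum_distrib_right sum_divide_distrib
  by (intro sum.cong refl) simp

text \<open>Two of the four powers of the norm are absorbed by the components of r, the other two by
  the quadratic smallness of the normal component. At r = 0 the quotient is 0.\<close>

lemma traction_kernel_bound:
  assumes "C \<ge> 0" "\<bar>\<nu> \<bullet> r\<bar> \<le> C * (norm r)\<^sup>2"
  shows "\<bar>traction_kernel \<nu> r i k\<bar> \<le> C"
proof (cases "r = 0")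
  case True
  then show ?thesis using assms(1) by (simp add: traction_kernel_eq)
next
  case False
  have "\<bar>r $ i * r $ k\<bar> \<le> norm r * norm r"
    unfolding abs_mult by (intro mult_mono component_le_norm_cart) auto
  then have "\<bar>\<nu> \<bullet> r\<bar> * \<bar>r $ i * r $ k\<bar> \<le> (C * (norm r)\<^sup>2) * (norm r)\<^sup>2"
    using assms by (intro mult_mono) (auto simp: power2_eq_square intro: order_trans[OF abs_ge_zero])
  then have "\<bar>\<nu> \<bullet> r\<bar> * \<bar>r $ i * r $ k\<bar> \<le> C * norm r ^ 4"
    by (simp add: power2_eq_square power4_eq_xxxx mult.assoc)
  then show ?thesis
    using False by (simp add: traction_kernel_eq abs_mult pos_divide_le_eq)
qed

section \<open>Second-order tangency of chords\<close>

lemma differentiable_imp_locally_lipschitz_at: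
  fixes f :: "'a::real_normed_vector \<Rightarrow> 'b::real_normed_vector"
  assumes "f differentiable (at x)"
  obtains C d where "d > 0" "C \<ge> 0" "\<And>y. norm (y - x) < d \<Longrightarrow> norm (f y - f x) \<le> C * norm (y - x)"
proof -
  obtain f' where f': "(f has_derivative f') (at x)"
    using assms by (auto simp: differentiable_def)
  then obtain d where d: "d > 0" "\<And>y. norm (y - x) < d \<Longrightarrow> norm (f y - f x - f' (y - x)) \<le> 1 * norm (y - x)"
    unfolding has_derivative_at_alt by (metis zero_less_one)
  obtain K where K: "K \<ge> 0" "\<And>v. norm (f' v) \<le> norm v * K"
    using bounded_linear.nonneg_bounded[OF has_derivative_bounded_linear[OF f']] by blast
  show ?thesis
  proof (rule that[of d "1 + K"])
    fix y assume "norm (y - x) < d"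
    then show "norm (f y - f x) \<le> (1 + K) * norm (y - x)"
      using d(2)[of y] K(2)[of "y - x"] norm_triangle_sub[of "f y - f x" "f' (y - x)"]
      by (simp add: algebra_simps)
  qed (use d K in auto)
qed

lemma grad_differentiable:
  assumes "smooth_on_open U \<phi>" "x \<in> U"
  shows "grad \<phi> differentiable (at x)"
proof (subst differentiable_componentwise_within, intro ballI)
  fix b :: "real^2" assume "b \<in> Basis"
  then obtain i where b: "b = axis i 1" by (auto simp: Basis_vec_def)
  show "(\<lambda>x. grad \<phi> x \<bullet> b) differentiable (at x)"
    using smooth_on_open_differentiable[OF smooth_on_open_frechet_derivative[OF assms(1)] assms(2), of "axis i 1"]
    by (simp add: b inner_axis grad_def)
qed

text \<open>A defining function vanishes at both ends of a short chord, so its gradient at some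
  point of the chord is orthogonal to it. Passing to the gradient at x costs a factor proportional
  to the length of the chord. For chords of length at least s, Cauchy-Schwarz and 1 \<le> length / s
  suffice. The constant may depend on x.\<close>

lemma outer_normal_inner_chord_bound:
  assumes dom: "smooth_domain \<Omega>" and x: "x \<in> frontier \<Omega>"
  obtains C where "C \<ge> 0" "\<And>y. y \<in> frontier \<Omega> \<Longrightarrow> \<bar>outer_normal \<Omega> x \<bullet> (x - y)\<bar> \<le> C * (norm (x - y))\<^sup>2"
proof -
  obtain U \<phi> where ldf: "local_defining_function \<Omega> x U \<phi>"
    using dom x unfolding smooth_domain_def by blast
  note D = local_defining_functionD[OF ldf]
  define g where "g = grad \<phi> x"
  have g: "norm g > 0" using D(2,5) by (simp add: g_def)
  have n: "outer_normal \<Omega> x = sgn g" using outer_normal_eq[OF ldf x] by (simp add: g_def)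
  obtain C d where d: "d > 0" "C \<ge> 0" "\<And>y. norm (y - x) < d \<Longrightarrow> norm (grad \<phi> y - g) \<le> C * norm (y - x)"
    using differentiable_imp_locally_lipschitz_at[OF grad_differentiable[OF D(3,2)]] unfolding g_def by metis
  obtain s' where s': "s' > 0" "ball x s' \<subseteq> U"
    using D(1,2) open_contains_ball by blast
  define s where "s = min d s'"
  have s: "s > 0" "s \<le> d" "s \<le> s'" using d s' by (auto simp: s_def)
  show ?thesis
  proof (rule that[of "max (C / norm g) (1 / s)"])
    show "max (C / norm g) (1 / s) \<ge> 0" using s by (simp add: le_max_iff_disj)
  next
    fix y assume y: "y \<in> frontier \<Omega>"
    show "\<bar>outer_normal \<Omega> x \<bullet> (x - y)\<bar> \<le> max (C / norm g) (1 / s) * (norm (x - y))\<^sup>2"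
    proof (cases "norm (x - y) < s")
      case True
      have sub: "ball x s \<subseteq> U" using s s' by auto
      have yb: "y \<in> ball x s" using True by (simp add: dist_norm)
      have zero: "\<phi> x = 0" "\<phi> y = 0" using x y yb sub D(2,7) by auto
      obtain z where z: "z \<in> closed_segment y x" "\<phi> x - \<phi> y = grad \<phi> z \<bullet> (x - y)"
      proof (rule mvt_segment[of "ball x s" y x \<phi> "grad \<phi>"])
        show "(\<phi> has_derivative (\<lambda>v. grad \<phi> z \<bullet> v)) (at z)" if "z \<in> ball x s" for z
          using that sub by (intro has_derivative_grad D(4)) auto
      qed (use yb s in auto)
      have zx: "norm (z - x) \<le> norm (x - y)"
        using segment_bound(2)[OF z(1)] by (simp add: norm_minus_commute)
      have "g \<bullet> (x - y) = (g - grad \<phi> z) \<bullet> (x - y)"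
        using z zero by (simp add: inner_diff_left)
      then have "\<bar>g \<bullet> (x - y)\<bar> \<le> norm (g - grad \<phi> z) * norm (x - y)"
        using Cauchy_Schwarz_ineq2[of "g - grad \<phi> z" "x - y"] by simp
      also have "\<dots> \<le> (C * norm (x - y)) * norm (x - y)"
      proof (rule mult_right_mono)
        have "norm (g - grad \<phi> z) \<le> C * norm (z - x)"
          using d(3)[of z] zx True s by (simp add: norm_minus_commute)
        also have "\<dots> \<le> C * norm (x - y)" using zx d(2) by (rule mult_left_mono)
        finally show "norm (g - grad \<phi> z) \<le> C * norm (x - y)" .
      qed simp
      finally have "\<bar>sgn g \<bullet> (x - y)\<bar> \<le> (C / norm g) * (norm (x - y))\<^sup>2"
        using g by (simp add: sgn_div_norm abs_mult power2_eq_square field_simps)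
      also have "\<dots> \<le> max (C / norm g) (1 / s) * (norm (x - y))\<^sup>2"
        by (intro mult_right_mono) auto
      finally show ?thesis by (simp add: n)
    next
      case False
      have "\<bar>sgn g \<bullet> (x - y)\<bar> \<le> norm (x - y)"
        using Cauchy_Schwarz_ineq2[of "sgn g" "x - y"] g by (simp add: norm_sgn)
      also have "\<dots> \<le> (1 / s) * (norm (x - y))\<^sup>2"
        using False s mult_left_mono[of s "norm (x - y)" "norm (x - y)"] by (simp add: power2_eq_square field_simps)
      also have "\<dots> \<le> max (C / norm g) (1 / s) * (norm (x - y))\<^sup>2"
        by (intro mult_right_mono) auto
      finally show ?thesis by (simp add: n)
    qed
  qed
qed

section \<open>Smoothness of the far kernel and the formula for \<Sigma>\<close>

lemma offset_point_neq:
  assumes dom: "smooth_domain \<Omega>"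
    and h_pos: "\<forall>y\<in>frontier \<Omega>. 0 < h y"
    and segment: "\<forall>y\<in>frontier \<Omega>. {y + t *\<^sub>R outer_normal \<Omega> y | t. t \<in> {0..h y}} \<inter> frontier \<Omega> = {y}"
    and x: "x \<in> frontier \<Omega>" and y: "y \<in> frontier \<Omega>"
  shows "x \<noteq> y + h y *\<^sub>R outer_normal \<Omega> y"
proof
  assume eq: "x = y + h y *\<^sub>R outer_normal \<Omega> y"
  then have "x \<in> {y + t *\<^sub>R outer_normal \<Omega> y | t. t \<in> {0..h y}}"
    using h_pos y by force
  with segment x y have "x = y" by blast
  with eq h_pos y norm_outer_normal[OF dom y] show False by auto
qed

lemma times_cont_diff_on_grad:
  assumes "open U" "smooth_on_open U \<phi>"
  shows "times_cont_diff_on m U (grad \<phi>)"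
proof -
  have "times_cont_diff_on m U (\<lambda>x. \<Sum>i\<in>UNIV. frechet_derivative \<phi> (at x) (axis i 1) *\<^sub>R axis i (1::real))"
    using smooth_on_open_frechet_derivative[OF assms(2)]
    by (intro times_cont_diff_on_sum times_cont_diff_on_scaleR \<open>open U\<close> times_cont_diff_on_const)
      (auto simp: smooth_on_open_def)
  moreover have "(\<lambda>x. \<Sum>i\<in>UNIV. frechet_derivative \<phi> (at x) (axis i 1) *\<^sub>R axis i (1::real)) = grad \<phi>"
  proof
    show "(\<Sum>i\<in>UNIV. frechet_derivative \<phi> (at x) (axis i 1) *\<^sub>R axis i (1::real)) = grad \<phi> x" for x
      using basis_expansion[of "grad \<phi> x"] by (simp add: grad_def scalar_mult_eq_scaleR)
  qed
  ultimately show ?thesis by (simp only:)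
qed

text \<open>It supplies a smooth extension of the outer normal to a neighbourhood in the plane; off
  the boundary its values depend on the choice of \<phi>.\<close>

lemma times_cont_diff_on_sgn_grad:
  assumes "local_defining_function \<Omega> p U \<phi>"
  shows "times_cont_diff_on m U (\<lambda>x. sgn (grad \<phi> x))"
proof -
  note D = local_defining_functionD[OF assms]
  have eq: "(\<lambda>x. sgn (grad \<phi> x)) = (\<lambda>x. inverse (sqrt (grad \<phi> x \<bullet> grad \<phi> x)) *\<^sub>R grad \<phi> x)"
    by (auto simp: sgn_div_norm norm_eq_sqrt_inner)
  show ?thesis unfolding eq
    using D(5) by (intro times_cont_diff_on_scaleR times_cont_diff_on_inverse_sqrt times_cont_diff_on_inner
        times_cont_diff_on_grad D(1,3)) auto
qed

text \<open>Smoothness along the boundary asks for an extension to pairs of points of the plane. It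
  is obtained by replacing both normals and h by their local smooth extensions in the formula of the
  kernel.\<close>

lemma smooth_along_far_kernel:
  assumes dom: "smooth_domain \<Omega>"
    and h_pos: "\<forall>y\<in>frontier \<Omega>. 0 < h y"
    and h_smooth: "smooth_along (frontier \<Omega>) h"
    and segment: "\<forall>y\<in>frontier \<Omega>. {y + t *\<^sub>R outer_normal \<Omega> y | t. t \<in> {0..h y}} \<inter> frontier \<Omega> = {y}"
  shows "smooth_along (frontier \<Omega> \<times> frontier \<Omega>) (\<lambda>(x, y). far_kernel \<Omega> h x y i k)"
  unfolding smooth_along_def
proof
  fix pq assume pq: "pq \<in> frontier \<Omega> \<times> frontier \<Omega>"
  obtain p q where [simp]: "pq = (p, q)" by fastforce
  have p: "p \<in> frontier \<Omega>" and q: "q \<in> frontier \<Omega>" using pq by auto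
  obtain U \<phi> where U: "local_defining_function \<Omega> p U \<phi>"
    using dom p unfolding smooth_domain_def by blast
  obtain V \<psi> where V: "local_defining_function \<Omega> q V \<psi>"
    using dom q unfolding smooth_domain_def by blast
  obtain W g where W: "open W" "q \<in> W" "smooth_on_open W g" "\<forall>x\<in>frontier \<Omega> \<inter> W. h x = g x"
    using h_smooth q unfolding smooth_along_def by metis
  note DU = local_defining_functionD[OF U] and DV = local_defining_functionD[OF V]
  define Z0 where "Z0 = U \<times> (V \<inter> W)"
  have "open Z0" using DU(1) DV(1) W(1) by (simp add: Z0_def open_Times open_Int)
  have fst_smooth: "times_cont_diff_on m Z0 (\<lambda>z. f (fst z))"
    if "times_cont_diff_on m U f" for m and f :: "real^2 \<Rightarrow> 'c::real_normed_vector"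
    by (rule times_cont_diff_on_subset[OF times_cont_diff_on_compose_bounded_linear[OF DU(1) bounded_linear_fst that]])
      (auto simp: Z0_def)
  have snd_smooth: "times_cont_diff_on m Z0 (\<lambda>z. f (snd z))"
    if "times_cont_diff_on m (V \<inter> W) f" for m and f :: "real^2 \<Rightarrow> 'c::real_normed_vector"
    by (rule times_cont_diff_on_subset[OF times_cont_diff_on_compose_bounded_linear[OF open_Int[OF DV(1) W(1)] bounded_linear_snd that]])
      (auto simp: Z0_def)
  have ident: "times_cont_diff_on m S (\<lambda>x. x)" if "open S" for m and S :: "(real^2) set"
    by (cases m) (auto simp del: times_cont_diff_on.simps(2) intro: times_cont_diff_on_SucI[OF that has_derivative_ident] times_cont_diff_on_const)
  define N where "N z = sgn (grad \<phi> (fst z))" for z :: "(real^2) \<times> (real^2)"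
  define R where "R z = fst z + (- 1) *\<^sub>R (snd z + g (snd z) *\<^sub>R sgn (grad \<psi> (snd z)))" for z :: "(real^2) \<times> (real^2)"
  have N: "times_cont_diff_on m Z0 N" for m
    unfolding N_def by (rule fst_smooth[OF times_cont_diff_on_sgn_grad[OF U]])
  have R: "times_cont_diff_on m Z0 R" for m
    unfolding R_def
  proof (intro times_cont_diff_on_add times_cont_diff_on_scaleR \<open>open Z0\<close> times_cont_diff_on_const)
    show "times_cont_diff_on m Z0 (\<lambda>z. fst z)" by (rule fst_smooth[OF ident[OF DU(1)]])
    show "times_cont_diff_on m Z0 (\<lambda>z. snd z)" by (rule snd_smooth[OF ident[OF open_Int[OF DV(1) W(1)]]])
    show "times_cont_diff_on m Z0 (\<lambda>z. g (snd z))"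
      using W(3) by (intro snd_smooth) (auto simp: smooth_on_open_def intro: times_cont_diff_on_subset)
    show "times_cont_diff_on m Z0 (\<lambda>z. sgn (grad \<psi> (snd z)))"
      by (rule snd_smooth[OF times_cont_diff_on_subset[OF times_cont_diff_on_sgn_grad[OF V]]]) auto
  qed
  \<comment> \<open>The extended offset vector is known to be nonzero only for pairs on the
    boundary, so the neighbourhood is shrunk to where it does not vanish.\<close>
  define Z where "Z = Z0 \<inter> R -` (- {0})"
  have "open Z"
    unfolding Z_def by (rule continuous_open_preimage[OF times_cont_diff_on_imp_continuous_on[OF R] \<open>open Z0\<close>]) auto
  have NZ: "times_cont_diff_on m Z N" and RZ: "times_cont_diff_on m Z R" for m
    unfolding Z_def by (rule times_cont_diff_on_subset[OF N] times_cont_diff_on_subset[OF R]; blast)+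
  \<comment> \<open>This is the inverse norm of R; the fourth power arises from the four factors in
    \<open>F\<close>.\<close>
  define q4 where "q4 z = inverse (sqrt (R z \<bullet> R z))" for z
  have q4: "times_cont_diff_on m Z q4" for m
    unfolding q4_def by (intro times_cont_diff_on_inverse_sqrt times_cont_diff_on_inner RZ \<open>open Z\<close>) (auto simp: Z_def)
  have eqs: "N z = outer_normal \<Omega> (fst z)" "R z = fst z - (snd z + h (snd z) *\<^sub>R outer_normal \<Omega> (snd z))"
    if "z \<in> (frontier \<Omega> \<times> frontier \<Omega>) \<inter> Z0" for z
    using that W(4) outer_normal_eq[OF local_defining_function_move[OF U]] outer_normal_eq[OF local_defining_function_move[OF V]]
    by (auto simp: N_def R_def Z0_def)
  define F where "F z = (N z \<bullet> R z) * (R z $ i * R z $ k) * ((q4 z * q4 z) * (q4 z * q4 z))" for z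
  have "smooth_on_open Z F"
    unfolding smooth_on_open_def F_def
    by (intro allI times_cont_diff_on_mult times_cont_diff_on_inner \<open>open Z\<close> NZ RZ q4
      times_cont_diff_on_bounded_linear_compose[OF _ bounded_linear_vec_nth])
  moreover have "(p, q) \<in> Z"
  proof -
    have "(p, q) \<in> Z0" using DU(2) DV(2) W(2) by (simp add: Z0_def)
    moreover have "R (p, q) \<noteq> 0"
      using eqs(2)[of "(p, q)"] \<open>(p, q) \<in> Z0\<close> p q offset_point_neq[OF dom h_pos segment p q] by simp
    ultimately show ?thesis by (simp add: Z_def)
  qed
  moreover have "(case z of (x, y) \<Rightarrow> far_kernel \<Omega> h x y i k) = F z" if z: "z \<in> (frontier \<Omega> \<times> frontier \<Omega>) \<inter> Z" for z
  proof -
    have "z \<in> (frontier \<Omega> \<times> frontier \<Omega>) \<inter> Z0" using z by (auto simp: Z_def)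
    note e = eqs[OF this]
    have "q4 z = inverse (norm (R z))" by (simp add: q4_def norm_eq_sqrt_inner)
    then have "F z = (N z \<bullet> R z) * (R z $ i * R z $ k) / norm (R z) ^ 4"
      by (simp add: F_def divide_inverse power4_eq_xxxx mult.assoc)
    then show ?thesis
      by (simp add: far_kernel_def traction_kernel_eq e split_beta)
  qed
  ultimately show "\<exists>Z F. open Z \<and> pq \<in> Z \<and> smooth_on_open Z F \<and>
      (\<forall>z\<in>(frontier \<Omega> \<times> frontier \<Omega>) \<inter> Z. (case z of (x, y) \<Rightarrow> far_kernel \<Omega> h x y i k) = F z)"
    using \<open>open Z\<close> by (intro exI[of _ Z] exI[of _ F]) auto
qed

lemma SigmaB2_eq:
  assumes adm: "admissible_lame lam \<mu>" and dom: "smooth_domain \<Omega>"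
    and h_pos: "\<forall>y\<in>frontier \<Omega>. 0 < h y"
    and segment: "\<forall>y\<in>frontier \<Omega>. {y + t *\<^sub>R outer_normal \<Omega> y | t. t \<in> {0..h y}} \<inter> frontier \<Omega> = {y}"
    and x: "x \<in> frontier \<Omega>" and y: "y \<in> frontier \<Omega>" and "x \<noteq> y"
  shows "SigmaB2 lam \<mu> \<Omega> h x y i k = - (2 / pi) * near_kernel \<Omega> x y i k + 2 / pi * far_kernel \<Omega> h x y i k"
proof -
  have "x \<notin> {y + t *\<^sub>R outer_normal \<Omega> y | t. t \<in> {0..h y}}"
    using segment x y \<open>x \<noteq> y\<close> by blast
  note s = stress_matrix_KB2[OF adm norm_outer_normal[OF dom y] _ this]
  \<comment> \<open>\<open>SigmaB2\<close> contracts the first stress index and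
    \<open>traction_kernel\<close> its second component index. The two conventions agree because the
    product of components is symmetric.\<close>
  have rearrange: "n * (- c * (a * b * d / e) + c * (a' * b' * d' / e')) = - c * (n * (b * a * d / e)) + c * (n * (b' * a' * d' / e'))"
    for n c a b d e a' b' d' e' :: real
    by (simp add: algebra_simps)
  have "0 < h y" using h_pos y by blast
  then show ?thesis
    unfolding SigmaB2_def s[OF \<open>0 < h y\<close>] near_kernel_def far_kernel_def traction_kernel_def sum_distrib_left
      sum.distrib[symmetric]
    by (intro sum.cong refl) (rule rearrange)
qed

subsection \<open>Operators with continuous kernels\<close>

text \<open>The elementary t \<le> 1 + t^2 takes the place of Cauchy-Schwarz. The bound is not
  homogeneous, but it keeps bounded sets of \<open>L2\<close> bounded in mean, which is how it is
  used.\<close>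

lemma L2_integrable_norm:
  assumes "finite_measure M" "\<rho> \<in> L2 M"
  shows "integrable M (\<lambda>y. norm (\<rho> y))"
    and "(\<integral>y. norm (\<rho> y) \<partial>M) \<le> measure M (space M) + (L2_norm M \<rho>)\<^sup>2"
proof -
  interpret finite_measure M by fact
  have [measurable]: "\<rho> \<in> borel_measurable M" and sq: "integrable M (\<lambda>y. (norm (\<rho> y))\<^sup>2)"
    using assms(2) by (auto simp: L2_def)
  have bound: "norm v \<le> 1 + (norm v)\<^sup>2" for v :: "real^2"
    using self_le_power[of "norm v" 2] by (cases "norm v \<le> 1") (auto intro: add_increasing2)
  have int: "integrable M (\<lambda>y. 1 + (norm (\<rho> y))\<^sup>2)"
    using sq by simp
  show "integrable M (\<lambda>y. norm (\<rho> y))"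
    using bound by (intro Bochner_Integration.integrable_bound[OF int]) (auto intro!: AE_I2)
  then have "(\<integral>y. norm (\<rho> y) \<partial>M) \<le> (\<integral>y. 1 + (norm (\<rho> y))\<^sup>2 \<partial>M)"
    using int bound by (intro integral_mono) auto
  also have "\<dots> = measure M (space M) + (L2_norm M \<rho>)\<^sup>2"
    using sq by (simp add: L2_norm_def)
  finally show "(\<integral>y. norm (\<rho> y) \<partial>M) \<le> measure M (space M) + (L2_norm M \<rho>)\<^sup>2" .
qed

text \<open>The factor 2 counts the two components of the density.\<close>

lemma kernel_op_bounded_kernel:
  assumes M: "finite_measure M" and \<rho>: "\<rho> \<in> L2 M"
    and meas: "\<And>l. (\<lambda>y. k x y i l) \<in> borel_measurable M"
    and bound: "\<And>l y. y \<in> space M \<Longrightarrow> \<bar>k x y i l\<bar> \<le> B"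
  shows "integrable M (\<lambda>y. \<Sum>l\<in>UNIV. k x y i l * \<rho> y $ l)"
    and "\<bar>kernel_op M k \<rho> x $ i\<bar> \<le> 2 * B * (\<integral>y. norm (\<rho> y) \<partial>M)"
proof -
  have [measurable]: "\<rho> \<in> borel_measurable M" using \<rho> by (simp add: L2_def)
  note [measurable] = meas
  have comp [measurable]: "(\<lambda>y. \<rho> y $ l) \<in> borel_measurable M" for l
    using borel_measurable_continuous_on[of "\<lambda>v. v $ l" \<rho> M] by (simp add: continuous_on_component)
  have le: "\<bar>\<Sum>l\<in>UNIV. k x y i l * \<rho> y $ l\<bar> \<le> 2 * B * norm (\<rho> y)" if "y \<in> space M" for y
  proof -
    have "\<bar>k x y i l * \<rho> y $ l\<bar> \<le> B * norm (\<rho> y)" for l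
      unfolding abs_mult using bound[OF that, of l] component_le_norm_cart[of "\<rho> y" l]
      by (intro mult_mono) auto
    from this[of 1] this[of 2] show ?thesis by (simp add: sum_2)
  qed
  have int: "integrable M (\<lambda>y. 2 * B * norm (\<rho> y))"
    using L2_integrable_norm(1)[OF M \<rho>] by simp
  show *: "integrable M (\<lambda>y. \<Sum>l\<in>UNIV. k x y i l * \<rho> y $ l)"
    by (rule Bochner_Integration.integrable_bound[OF int])
      (measurable, auto intro!: AE_I2 order_trans[OF le] abs_ge_self)
  have "\<bar>kernel_op M k \<rho> x $ i\<bar> \<le> (\<integral>y. \<bar>\<Sum>l\<in>UNIV. k x y i l * \<rho> y $ l\<bar> \<partial>M)"
    unfolding kernel_op_def vec_lambda_beta by (rule integral_abs_bound)
  also have "\<dots> \<le> (\<integral>y. 2 * B * norm (\<rho> y) \<partial>M)"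
    using * int le by (intro integral_mono) auto
  finally show "\<bar>kernel_op M k \<rho> x $ i\<bar> \<le> 2 * B * (\<integral>y. norm (\<rho> y) \<partial>M)" by simp
qed

lemma continuous_on_imp_measurable:
  assumes "sets M = sets (restrict_space borel S)" "continuous_on S f"
  shows "f \<in> borel_measurable M"
  using borel_measurable_continuous_on_restrict[OF assms(2)] measurable_cong_sets[OF assms(1) refl] by blast

lemma continuous_on_imp_L2:
  assumes M: "finite_measure M" "sets M = sets (restrict_space borel S)" "space M = S"
    and "compact S" "continuous_on S f"
  shows "f \<in> L2 M"
proof -
  interpret finite_measure M by fact
  have [measurable]: "f \<in> borel_measurable M"
    using continuous_on_imp_measurable assms by blast
  obtain B where B: "\<And>x. x \<in> S \<Longrightarrow> norm (f x) \<le> B"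
    using compact_imp_bounded[OF compact_continuous_image[OF assms(5,4)]] by (auto simp: bounded_iff)
  have "integrable M (\<lambda>x. (norm (f x))\<^sup>2)"
    using B M(3) by (intro integrable_const_bound[of _ "B\<^sup>2"]) (auto intro!: AE_I2 power_mono)
  then show ?thesis by (simp add: L2_def)
qed

text \<open>Densities bounded in \<open>L2\<close> are bounded in mean, and the kernel is uniformly
  continuous, so their images are uniformly bounded and equicontinuous. A uniformly convergent
  subsequence converges in \<open>L2\<close> because the measure is finite.\<close>

lemma compact_operator_continuous_kernel:
  assumes M: "finite_measure M" "sets M = sets (restrict_space borel S)" "space M = S"
    and S: "compact S"
    and cont: "\<And>i l. continuous_on (S \<times> S) (\<lambda>(x, y). k x y i l)"
  shows "compact_operator_L2 M (kernel_op M k)"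
proof -
  interpret finite_measure M by fact
  have "compact (S \<times> S)" using S by (simp add: compact_Times)
  have "\<exists>B. \<forall>z\<in>S \<times> S. \<bar>case z of (x, y) \<Rightarrow> k x y i l\<bar> \<le> B" for i l
    using compact_imp_bounded[OF compact_continuous_image[OF cont[of i l] \<open>compact (S \<times> S)\<close>]]
    by (auto simp: bounded_iff)
  then obtain b where b: "\<And>i l x y. x \<in> S \<Longrightarrow> y \<in> S \<Longrightarrow> \<bar>k x y i l\<bar> \<le> b i l"
    by (metis (mono_tags, lifting) SigmaI case_prod_conv)
  define B where "B = (\<Sum>i\<in>UNIV. \<Sum>l\<in>UNIV. \<bar>b i l\<bar>)"
  have B: "\<bar>k x y i l\<bar> \<le> B" if "x \<in> S" "y \<in> S" for i l x y
  proof -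
    have "\<bar>k x y i l\<bar> \<le> \<bar>b i l\<bar>" using b[OF that, of i l] by linarith
    also have "\<dots> \<le> (\<Sum>l\<in>UNIV. \<bar>b i l\<bar>)" by (rule member_le_sum) auto
    also have "\<dots> \<le> B" unfolding B_def by (rule member_le_sum[of i UNIV]) (auto intro: sum_nonneg)
    finally show ?thesis .
  qed
  have sect: "continuous_on S (\<lambda>y. k x y i l)" if "x \<in> S" for x i l
    using continuous_on_compose2[OF cont[of i l] continuous_on_Pair[OF continuous_on_const[of S x] continuous_on_id[of S]]] that
    by auto
  have meas: "(\<lambda>y. k x y i l) \<in> borel_measurable M" if "x \<in> S" for x i l
    by (rule continuous_on_imp_measurable[OF M(2) sect[OF that]])
  have int: "integrable M (\<lambda>y. \<Sum>l\<in>UNIV. k x y i l * \<rho> y $ l)" if "\<rho> \<in> L2 M" "x \<in> S" for \<rho> x i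
    by (rule kernel_op_bounded_kernel(1)[OF M(1) that(1), of k x i B]) (use meas B M(3) that in auto)
  have norm_le: "norm v \<le> 2 * c" if "\<And>i. \<bar>v $ i\<bar> \<le> c" for v :: "real^2" and c
    using norm_le_l1_cart[of v] that[of 1] that[of 2] by (simp add: sum_2)
  have bounded: "norm (kernel_op M k \<rho> x) \<le> 2 * (2 * B * (\<integral>y. norm (\<rho> y) \<partial>M))"
    if "\<rho> \<in> L2 M" "x \<in> S" for \<rho> x
    by (intro norm_le kernel_op_bounded_kernel(2)[OF M(1) that(1)]) (use meas B M(3) that in auto)
  have equi: "\<exists>d>0. \<forall>x\<in>S. \<forall>x'\<in>S. \<forall>\<rho>\<in>L2 M. norm (x - x') < d \<longrightarrow>
      norm (kernel_op M k \<rho> x - kernel_op M k \<rho> x') \<le> 2 * (2 * e * (\<integral>y. norm (\<rho> y) \<partial>M))"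
    if "e > 0" for e
  proof -
    have "\<exists>d>0. \<forall>x\<in>S. \<forall>x'\<in>S. \<forall>y\<in>S. norm (x - x') < d \<longrightarrow> \<bar>k x y i l - k x' y i l\<bar> \<le> e" for i l
    proof -
      have "uniformly_continuous_on (S \<times> S) (\<lambda>(x, y). k x y i l)"
        by (rule compact_uniformly_continuous[OF cont \<open>compact (S \<times> S)\<close>])
      then obtain d where d: "d > 0" "\<And>z z'. z \<in> S \<times> S \<Longrightarrow> z' \<in> S \<times> S \<Longrightarrow> dist z' z < d \<Longrightarrow>
          dist (case z' of (x, y) \<Rightarrow> k x y i l) (case z of (x, y) \<Rightarrow> k x y i l) < e"
        unfolding uniformly_continuous_on_def using \<open>e > 0\<close> by blast
      show ?thesis
      proof (intro exI[of _ d] conjI ballI impI d(1))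
        fix x x' y assume "x \<in> S" "x' \<in> S" "y \<in> S" "norm (x - x') < d"
        then show "\<bar>k x y i l - k x' y i l\<bar> \<le> e"
          using d(2)[of "(x', y)" "(x, y)"] by (simp add: dist_Pair_Pair dist_norm)
      qed
    qed
    then obtain d where d: "\<And>i l. d i l > (0::real)"
      "\<And>i l x x' y. x \<in> S \<Longrightarrow> x' \<in> S \<Longrightarrow> y \<in> S \<Longrightarrow> norm (x - x') < d i l \<Longrightarrow> \<bar>k x y i l - k x' y i l\<bar> \<le> e"
      by metis
    define d0 where "d0 = Min (range (\<lambda>(i, l). d i l))"
    have "d0 > 0" using d(1) by (auto simp: d0_def)
    have d0: "d0 \<le> d i l" for i l unfolding d0_def by (rule Min_le) auto
    show ?thesis
    proof (intro exI[of _ d0] conjI ballI impI \<open>d0 > 0\<close>)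
      fix x x' \<rho> assume x: "x \<in> S" "x' \<in> S" and \<rho>: "\<rho> \<in> L2 M" and near: "norm (x - x') < d0"
      \<comment> \<open>A kernel constant in its first argument, so that the estimate for bounded
        kernels applies to the difference of two values of the operator.\<close>
      let ?k = "\<lambda>_ y i l. k x y i l - k x' y i l"
      have "kernel_op M ?k \<rho> x = kernel_op M k \<rho> x - kernel_op M k \<rho> x'"
        unfolding kernel_op_def vec_eq_iff
        using int[OF \<rho> x(1)] int[OF \<rho> x(2)]
        by (simp add: left_diff_distrib sum_subtractf)
      moreover have "norm (kernel_op M ?k \<rho> x) \<le> 2 * (2 * e * (\<integral>y. norm (\<rho> y) \<partial>M))"
      proof (intro norm_le kernel_op_bounded_kernel(2)[OF M(1) \<rho>])
        show "(\<lambda>y. k x y i l - k x' y i l) \<in> borel_measurable M" for i l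
          using meas[OF x(1)] meas[OF x(2)] by measurable
        show "\<bar>k x y i l - k x' y i l\<bar> \<le> e" if "y \<in> space M" for y i l
          using d(2)[OF x, of y i l] d0[of i l] near that M(3) by auto
      qed
      ultimately show "norm (kernel_op M k \<rho> x - kernel_op M k \<rho> x') \<le> 2 * (2 * e * (\<integral>y. norm (\<rho> y) \<partial>M))"
        by simp
    qed
  qed
  have equicont: "\<exists>d>0. \<forall>\<rho>\<in>L2 M. (\<integral>y. norm (\<rho> y) \<partial>M) \<le> Q \<longrightarrow>
      (\<forall>x\<in>S. \<forall>x'\<in>S. norm (x - x') < d \<longrightarrow> norm (kernel_op M k \<rho> x - kernel_op M k \<rho> x') < e)"
    if "e > 0" for e Q
  proof -
    \<comment> \<open>The summand 1 keeps q positive and the final estimate strict; the 4 in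
      \<open>e'\<close> is the constant 2 * 2 of \<open>equi\<close>.\<close>
    define q where "q = \<bar>Q\<bar> + 1"
    have "q > 0" by (simp add: q_def)
    define e' where "e' = e / (4 * q)"
    have "e' > 0" using \<open>e > 0\<close> \<open>q > 0\<close> by (simp add: e'_def)
    then obtain d where d: "d > 0" "\<And>x x' \<rho>. x \<in> S \<Longrightarrow> x' \<in> S \<Longrightarrow> \<rho> \<in> L2 M \<Longrightarrow> norm (x - x') < d \<Longrightarrow>
        norm (kernel_op M k \<rho> x - kernel_op M k \<rho> x') \<le> 2 * (2 * e' * (\<integral>y. norm (\<rho> y) \<partial>M))"
      using equi[of e'] by blast
    show ?thesis
    proof (intro exI[of _ d] conjI ballI impI d(1))
      fix \<rho> x x' assume *: "\<rho> \<in> L2 M" "(\<integral>y. norm (\<rho> y) \<partial>M) \<le> Q" "x \<in> S" "x' \<in> S" "norm (x - x') < d"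
      have "norm (kernel_op M k \<rho> x - kernel_op M k \<rho> x') \<le> 4 * e' * (\<integral>y. norm (\<rho> y) \<partial>M)"
        using d(2)[OF *(3,4,1,5)] by simp
      also have "\<dots> < 4 * e' * q"
        using *(2) \<open>e' > 0\<close> by (intro mult_strict_left_mono) (auto simp: q_def)
      also have "\<dots> = e" using \<open>q > 0\<close> by (simp add: e'_def)
      finally show "norm (kernel_op M k \<rho> x - kernel_op M k \<rho> x') < e" .
    qed
  qed
  have cont_op: "continuous_on S (kernel_op M k \<rho>)" if "\<rho> \<in> L2 M" for \<rho>
    unfolding continuous_on_iff dist_norm using equicont[where Q = "\<integral>y. norm (\<rho> y) \<partial>M"] that
    by (metis norm_minus_commute order_refl)
  note L2_cont = continuous_on_imp_L2[OF M S]
  show ?thesis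
    unfolding compact_operator_L2_def
  proof (intro conjI ballI allI impI)
    show "kernel_op M k \<rho> \<in> L2 M" if "\<rho> \<in> L2 M" for \<rho>
      by (rule L2_cont[OF cont_op[OF that]])
  next
    fix \<rho> \<tau> a b assume \<rho>: "\<rho> \<in> L2 M" and \<tau>: "\<tau> \<in> L2 M"
    show "AE x in M. kernel_op M k (\<lambda>y. a *\<^sub>R \<rho> y + b *\<^sub>R \<tau> y) x = a *\<^sub>R kernel_op M k \<rho> x + b *\<^sub>R kernel_op M k \<tau> x"
    proof (rule AE_I2)
      fix x assume "x \<in> space M"
      then have x: "x \<in> S" using M(3) by simp
      have "(\<Sum>l\<in>UNIV. k x y i l * (a *\<^sub>R \<rho> y + b *\<^sub>R \<tau> y) $ l)
          = a * (\<Sum>l\<in>UNIV. k x y i l * \<rho> y $ l) + b * (\<Sum>l\<in>UNIV. k x y i l * \<tau> y $ l)" for y i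
        by (simp add: sum_2 algebra_simps)
      then show "kernel_op M k (\<lambda>y. a *\<^sub>R \<rho> y + b *\<^sub>R \<tau> y) x = a *\<^sub>R kernel_op M k \<rho> x + b *\<^sub>R kernel_op M k \<tau> x"
        using int[OF \<rho> x] int[OF \<tau> x] unfolding kernel_op_def vec_eq_iff by simp
    qed
  next
    fix \<rho> :: "nat \<Rightarrow> real^2 \<Rightarrow> real^2" and B' assume \<rho>: "\<forall>n. \<rho> n \<in> L2 M \<and> L2_norm M (\<rho> n) \<le> B'"
    define Q where "Q = measure M (space M) + B'\<^sup>2"
    have Q: "(\<integral>y. norm (\<rho> n y) \<partial>M) \<le> Q" for n
    proof -
      have "(L2_norm M (\<rho> n))\<^sup>2 \<le> B'\<^sup>2"
        using \<rho> by (intro power_mono) (auto simp: L2_norm_def)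
      then show ?thesis using L2_integrable_norm(2)[OF M(1), of "\<rho> n"] \<rho> by (simp add: Q_def)
    qed
    have BQ: "norm (kernel_op M k (\<rho> n) x) \<le> 2 * (2 * \<bar>B\<bar> * Q)" if "x \<in> S" for n x
    proof -
      have "B * (\<integral>y. norm (\<rho> n y) \<partial>M) \<le> \<bar>B\<bar> * Q"
        using Q[of n] by (intro mult_mono) auto
      then show ?thesis using bounded[of "\<rho> n" x] \<rho> that by simp
    qed
    obtain g s where g: "continuous_on S g" "strict_mono (s :: nat \<Rightarrow> nat)"
      "\<And>e. 0 < e \<Longrightarrow> \<exists>N. \<forall>n x. n \<ge> N \<and> x \<in> S \<longrightarrow> norm (kernel_op M k (\<rho> (s n)) x - g x) < e"
    proof (rule Arzela_Ascoli[OF S, of "\<lambda>n. kernel_op M k (\<rho> n)"])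
      show "norm (kernel_op M k (\<rho> n) x) \<le> 2 * (2 * \<bar>B\<bar> * Q)" if "x \<in> S" for n x
        by (rule BQ[OF that])
      show "\<exists>d>0. \<forall>n y. y \<in> S \<and> norm (x - y) < d \<longrightarrow> norm (kernel_op M k (\<rho> n) x - kernel_op M k (\<rho> n) y) < e"
        if "x \<in> S" "0 < e" for x e
        using equicont[OF that(2), of Q] Q \<rho> that(1) by metis
    qed (use that in blast)
    have "(\<lambda>n. L2_norm M (\<lambda>x. kernel_op M k (\<rho> (s n)) x - g x)) \<longlonglongrightarrow> 0"
    proof (rule LIMSEQ_I)
      fix r :: real assume "r > 0"
      define m where "m = measure M (space M)"
      have "m \<ge> 0" by (simp add: m_def)
      \<comment> \<open>The summand 1 allows for total measure 0 and gives a strict inequality in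
        the end.\<close>
      define e where "e = r / (sqrt m + 1)"
      have "sqrt m + 1 > 0" using \<open>m \<ge> 0\<close> by (intro add_nonneg_pos) auto
      then have e: "e > 0" using \<open>r > 0\<close> by (simp add: e_def)
      obtain N where N: "\<And>n x. n \<ge> N \<Longrightarrow> x \<in> S \<Longrightarrow> norm (kernel_op M k (\<rho> (s n)) x - g x) < e"
        using g(3)[OF e] by blast
      have "norm (L2_norm M (\<lambda>x. kernel_op M k (\<rho> (s n)) x - g x) - 0) < r" if "n \<ge> N" for n
      proof -
        let ?f = "\<lambda>x. kernel_op M k (\<rho> (s n)) x - g x"
        have "continuous_on S ?f"
          using \<rho> by (intro continuous_on_diff cont_op g(1)) auto
        then have "integrable M (\<lambda>x. (norm (?f x))\<^sup>2)" using L2_cont by (simp add: L2_def)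
        then have "(\<integral>x. (norm (?f x))\<^sup>2 \<partial>M) \<le> (\<integral>x. e\<^sup>2 \<partial>M)"
          using N[OF that] M(3) by (intro integral_mono power_mono) (auto intro: less_imp_le)
        also have "\<dots> = m * e\<^sup>2" by (simp add: m_def)
        finally have "L2_norm M ?f \<le> sqrt (m * e\<^sup>2)" by (simp add: L2_norm_def)
        also have "\<dots> = sqrt m * e" using e by (simp add: real_sqrt_mult)
        also have "\<dots> < (sqrt m + 1) * e" using e by simp
        also have "\<dots> = r" using \<open>sqrt m + 1 > 0\<close> by (simp add: e_def)
        finally show ?thesis by (simp add: L2_norm_def)
      qed
      then show "\<exists>no. \<forall>n\<ge>no. norm (L2_norm M (\<lambda>x. kernel_op M k (\<rho> (s n)) x - g x) - 0) < r" by blast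
    qed
    then show "\<exists>s g. strict_mono s \<and> g \<in> L2 M \<and> (\<lambda>n. L2_norm M (\<lambda>x. kernel_op M k (\<rho> (s n)) x - g x)) \<longlonglongrightarrow> 0"
      using g(2) L2_cont[OF g(1)] by blast
  qed
qed

section \<open>Existence of the integrals and conclusion\<close>

lemma integrable_continuous_kernel_section:
  assumes M: "finite_measure M" "sets M = sets (restrict_space borel S)" "space M = S" "compact S"
    and cont: "\<And>l. continuous_on S (\<lambda>y. k x y i l)" and \<rho>: "\<rho> \<in> L2 M"
  shows "integrable M (\<lambda>y. \<Sum>l\<in>UNIV. k x y i l * \<rho> y $ l)"
proof -
  have "\<exists>B. \<forall>y\<in>S. \<bar>k x y i l\<bar> \<le> B" for l
    using compact_imp_bounded[OF compact_continuous_image[OF cont[of l] M(4)]] by (auto simp: bounded_iff)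
  then obtain b where b: "\<And>l y. y \<in> S \<Longrightarrow> \<bar>k x y i l\<bar> \<le> b l" by metis
  show ?thesis
  proof (rule kernel_op_bounded_kernel(1)[OF M(1) \<rho>])
    show "(\<lambda>y. k x y i l) \<in> borel_measurable M" for l
      by (rule continuous_on_imp_measurable[OF M(2) cont])
    show "\<bar>k x y i l\<bar> \<le> max (b 1) (b 2)" if "y \<in> space M" for l y
      using b[of y l] that M(3) exhaust_2[of l] by auto
  qed
qed

text \<open>The chord bound makes the kernel bounded in y. Measurability is taken from the formula
  and not from continuity, since at y = x the formula gives 0 whatever the limit there may
  be.\<close>

lemma near_kernel_integrable:
  assumes dom: "smooth_domain \<Omega>" and x: "x \<in> frontier \<Omega>" and \<rho>: "\<rho> \<in> L2 (arc_length \<Omega>)"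
  shows "integrable (arc_length \<Omega>) (\<lambda>y. \<Sum>l\<in>UNIV. near_kernel \<Omega> x y i l * \<rho> y $ l)"
proof -
  obtain C where C: "C \<ge> 0"
    "\<And>y. y \<in> frontier \<Omega> \<Longrightarrow> \<bar>outer_normal \<Omega> x \<bullet> (x - y)\<bar> \<le> C * (norm (x - y))\<^sup>2"
    using outer_normal_inner_chord_bound[OF dom x] by blast
  show ?thesis
  proof (rule kernel_op_bounded_kernel(1)[OF finite_measure_arc_length[OF dom] \<rho>])
    have comp [measurable]: "(\<lambda>y. (x - y) $ j) \<in> borel_measurable borel" for j
      by (intro borel_measurable_continuous_onI continuous_intros)
    have "(\<lambda>y. near_kernel \<Omega> x y i l) \<in> borel_measurable borel" for l
      unfolding near_kernel_def traction_kernel_eq by measurable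
    then have "(\<lambda>y. near_kernel \<Omega> x y i l) \<in> borel_measurable (restrict_space borel (frontier \<Omega>))" for l
      by (rule measurable_restrict_space1)
    then show "(\<lambda>y. near_kernel \<Omega> x y i l) \<in> borel_measurable (arc_length \<Omega>)" for l
      using measurable_cong_sets[OF sets_arc_length refl] by blast
    show "\<bar>near_kernel \<Omega> x y i l\<bar> \<le> C" if "y \<in> space (arc_length \<Omega>)" for l y
      unfolding near_kernel_def using C that by (intro traction_kernel_bound) auto
  qed
qed

text \<open>Almost everywhere equality alone does not make f measurable, as M need not be complete.
  Here f differs from g only on a measurable singleton, which does.\<close>

lemma has_bochner_integral_modify_point:
  fixes f g :: "real^2 \<Rightarrow> real"
  assumes g: "integrable M g" and x: "{x} \<in> sets M" "AE y in M. y \<noteq> x"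
    and eq: "\<And>y. y \<in> space M \<Longrightarrow> y \<noteq> x \<Longrightarrow> f y = g y"
  shows "has_bochner_integral M f (integral\<^sup>L M g)"
proof -
  have gm [measurable]: "g \<in> borel_measurable M" using g by simp
  have "(\<lambda>y. if y \<in> {x} then f x else g y) \<in> borel_measurable M"
    using x(1) by (intro measurable_If_set) (auto simp: sets.Int_space_eq2)
  then have fm: "f \<in> borel_measurable M"
    by (rule measurable_cong[THEN iffD1, rotated]) (auto simp: eq)
  have "AE y in M. g y = f y"
    using x(2) by (rule AE_mp) (auto simp: eq)
  then show ?thesis
    using has_bochner_integral_cong_AE[OF gm fm] has_bochner_integral_integrable[OF g] by blast
qed

theorem mainTheorem3:
  fixes \<Omega> :: "(real^2) set" and h :: "real^2 \<Rightarrow> real"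
  assumes domain: "smooth_domain \<Omega>"
    and h_pos: "\<forall>y\<in>frontier \<Omega>. 0 < h y"
    and h_smooth: "smooth_along (frontier \<Omega>) h"
    and segment: "\<forall>y\<in>frontier \<Omega>.
      {y + t *\<^sub>R outer_normal \<Omega> y | t. t \<in> {0..h y}} \<inter> frontier \<Omega> = {y}"
  shows "
    \<comment> \<open>the integrals exist\<close>
    (\<forall>lam \<mu>. admissible_lame lam \<mu> \<longrightarrow>
      (\<forall>\<rho>\<in>L2 (arc_length \<Omega>). \<forall>x\<in>frontier \<Omega>.
        kernel_op_integrable (arc_length \<Omega>) (SigmaB2 lam \<mu> \<Omega> h) \<rho> x \<and>
        kernel_op_integrable (arc_length \<Omega>) (near_kernel \<Omega>) \<rho> x \<and>
        kernel_op_integrable (arc_length \<Omega>) (far_kernel \<Omega> h) \<rho> x)) \<and>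
    \<comment> \<open>independence of the Lame parameters\<close>
    (\<forall>lam \<mu> lam' \<mu>'. admissible_lame lam \<mu> \<longrightarrow> admissible_lame lam' \<mu>' \<longrightarrow>
      (\<forall>\<rho>\<in>L2 (arc_length \<Omega>). \<forall>x\<in>frontier \<Omega>.
        kernel_op (arc_length \<Omega>) (SigmaB2 lam \<mu> \<Omega> h) \<rho> x
          = kernel_op (arc_length \<Omega>) (SigmaB2 lam' \<mu>' \<Omega> h) \<rho> x)) \<and>
    \<comment> \<open>the explicit form\<close>
    (\<forall>lam \<mu>. admissible_lame lam \<mu> \<longrightarrow>
      (\<forall>\<rho>\<in>L2 (arc_length \<Omega>). \<forall>f\<in>L2 (arc_length \<Omega>). \<forall>x\<in>frontier \<Omega>.
        equation_at lam \<mu> \<Omega> h \<rho> f x \<longleftrightarrow> explicit_equation_at \<Omega> h \<rho> f x)) \<and>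
    \<comment> \<open>the operator on the right-hand side\<close>
    (\<forall>i k. smooth_along (frontier \<Omega> \<times> frontier \<Omega>) (\<lambda>(x, y). far_kernel \<Omega> h x y i k)) \<and>
    compact_operator_L2 (arc_length \<Omega>) (kernel_op (arc_length \<Omega>) (far_kernel \<Omega> h)) \<and>
    \<comment> \<open>solvability for data in \<open>W\<close> by densities in \<open>V\<close>\<close>
    (\<forall>lam \<mu> lam' \<mu>' V W. admissible_lame lam \<mu> \<longrightarrow> admissible_lame lam' \<mu>' \<longrightarrow>
      V \<subseteq> L2 (arc_length \<Omega>) \<longrightarrow> W \<subseteq> L2 (arc_length \<Omega>) \<longrightarrow>
      (\<forall>f\<in>W. \<exists>\<rho>\<in>V. solves lam \<mu> \<Omega> h \<rho> f) \<longrightarrow>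
      (\<forall>f\<in>W. \<exists>\<rho>\<in>V. solves lam' \<mu>' \<Omega> h \<rho> f))"
proof -
  let ?M = "arc_length \<Omega>"
  let ?S = "frontier \<Omega>"
  have S: "compact ?S" using domain by (simp add: smooth_domain_def)
  note M = finite_measure_arc_length[OF domain] sets_arc_length[of \<Omega>] space_arc_length[of \<Omega>]
  note smooth = smooth_along_far_kernel[OF domain h_pos h_smooth segment]
  note cont = smooth_along_imp_continuous_on[OF smooth]
  have far: "integrable ?M (\<lambda>y. \<Sum>l\<in>UNIV. far_kernel \<Omega> h x y i l * \<rho> y $ l)"
    if "\<rho> \<in> L2 ?M" "x \<in> ?S" for \<rho> x i
  proof (rule integrable_continuous_kernel_section[OF M S _ that(1)])
    show "continuous_on ?S (\<lambda>y. far_kernel \<Omega> h x y i l)" for l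
      using continuous_on_compose2[OF cont[of i l]
          continuous_on_Pair[OF continuous_on_const[of ?S x] continuous_on_id[of ?S]]] that(2)
      by auto
  qed
  note near = near_kernel_integrable[OF domain]
  \<comment> \<open>The form \<open>has_bochner_integral\<close> yields at once that the integral
    exists and what it is.\<close>
  have Sigma: "has_bochner_integral ?M (\<lambda>y. \<Sum>l\<in>UNIV. SigmaB2 lam \<mu> \<Omega> h x y i l * \<rho> y $ l)
      (- (2 / pi) * kernel_op ?M (near_kernel \<Omega>) \<rho> x $ i + 2 / pi * kernel_op ?M (far_kernel \<Omega> h) \<rho> x $ i)"
    if adm: "admissible_lame lam \<mu>" and \<rho>: "\<rho> \<in> L2 ?M" and x: "x \<in> ?S" for lam \<mu> \<rho> x i
  proof -
    let ?g = "\<lambda>y. - (2 / pi) * (\<Sum>l\<in>UNIV. near_kernel \<Omega> x y i l * \<rho> y $ l)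
      + 2 / pi * (\<Sum>l\<in>UNIV. far_kernel \<Omega> h x y i l * \<rho> y $ l)"
    have "integrable ?M ?g"
      using near[OF x \<rho>] far[OF \<rho> x] by (intro Bochner_Integration.integrable_add integrable_mult_right)
    moreover have "{x} \<in> sets ?M"
      using x by (auto simp: sets_restrict_space intro!: image_eqI[of _ _ "{x}"])
    moreover have "(\<Sum>l\<in>UNIV. SigmaB2 lam \<mu> \<Omega> h x y i l * \<rho> y $ l) = ?g y" if "y \<in> space ?M" "y \<noteq> x" for y
    proof -
      have eq: "SigmaB2 lam \<mu> \<Omega> h x y i l = - (2 / pi) * near_kernel \<Omega> x y i l + 2 / pi * far_kernel \<Omega> h x y i l" for l
        using SigmaB2_eq[OF adm domain h_pos segment x, of y i l] that by simp
      show ?thesis unfolding eq sum_2 by (simp add: algebra_simps)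
    qed
    ultimately have "has_bochner_integral ?M (\<lambda>y. \<Sum>l\<in>UNIV. SigmaB2 lam \<mu> \<Omega> h x y i l * \<rho> y $ l) (integral\<^sup>L ?M ?g)"
      using AE_arc_length_neq[OF x] by (intro has_bochner_integral_modify_point)
    moreover have "integral\<^sup>L ?M ?g = - (2 / pi) * kernel_op ?M (near_kernel \<Omega>) \<rho> x $ i
        + 2 / pi * kernel_op ?M (far_kernel \<Omega> h) \<rho> x $ i"
      using near[OF x \<rho>, of i] far[OF \<rho> x, of i] unfolding kernel_op_def vec_lambda_beta
      by (subst Bochner_Integration.integral_add) (simp_all only: integrable_mult_right integral_mult_right_zero)
    ultimately show ?thesis by simp
  qed
  have op: "kernel_op ?M (SigmaB2 lam \<mu> \<Omega> h) \<rho> x $ i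
      = - (2 / pi) * kernel_op ?M (near_kernel \<Omega>) \<rho> x $ i + 2 / pi * kernel_op ?M (far_kernel \<Omega> h) \<rho> x $ i"
    if "admissible_lame lam \<mu>" "\<rho> \<in> L2 ?M" "x \<in> ?S" for lam \<mu> \<rho> x i
    using has_bochner_integral_integral_eq[OF Sigma[OF that, of i]] by (simp add: kernel_op_def)
  have independent: "kernel_op ?M (SigmaB2 lam \<mu> \<Omega> h) \<rho> x = kernel_op ?M (SigmaB2 lam' \<mu>' \<Omega> h) \<rho> x"
    if "admissible_lame lam \<mu>" "admissible_lame lam' \<mu>'" "\<rho> \<in> L2 ?M" "x \<in> ?S" for lam \<mu> lam' \<mu>' \<rho> x
    using that by (simp only: vec_eq_iff op simp_thms)
  show ?thesis
  proof (intro conjI allI impI ballI)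
    show "kernel_op_integrable ?M (SigmaB2 lam \<mu> \<Omega> h) \<rho> x"
      if "admissible_lame lam \<mu>" "\<rho> \<in> L2 ?M" "x \<in> ?S" for lam \<mu> \<rho> x
      unfolding kernel_op_integrable_def using integrable.intros[OF Sigma[OF that]] by blast
    show "kernel_op_integrable ?M (near_kernel \<Omega>) \<rho> x" if "\<rho> \<in> L2 ?M" "x \<in> ?S" for \<rho> x
      unfolding kernel_op_integrable_def using near that by blast
    show "kernel_op_integrable ?M (far_kernel \<Omega> h) \<rho> x" if "\<rho> \<in> L2 ?M" "x \<in> ?S" for \<rho> x
      unfolding kernel_op_integrable_def using far that by blast
    show "kernel_op ?M (SigmaB2 lam \<mu> \<Omega> h) \<rho> x = kernel_op ?M (SigmaB2 lam' \<mu>' \<Omega> h) \<rho> x"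
      if "admissible_lame lam \<mu>" "admissible_lame lam' \<mu>'" "\<rho> \<in> L2 ?M" "x \<in> ?S" for lam \<mu> lam' \<mu>' \<rho> x
      using that by (rule independent)
    show "equation_at lam \<mu> \<Omega> h \<rho> f x \<longleftrightarrow> explicit_equation_at \<Omega> h \<rho> f x"
      if "admissible_lame lam \<mu>" "\<rho> \<in> L2 ?M" "f \<in> L2 ?M" "x \<in> ?S" for lam \<mu> \<rho> f x
    proof -
      \<comment> \<open>The explicit form is half of the equation with the far term moved to the
        right, whence 1 / 2 and 1 / pi.\<close>
      have "a + (- (2 / pi) * n + 2 / pi * m) = c \<longleftrightarrow> 1/2 * a - 1/pi * n = 1/2 * c - 1/pi * m" for a n m c :: real
        by (simp add: field_simps)
      then show ?thesis
        unfolding equation_at_def explicit_equation_at_def op[OF that(1,2,4)] by (simp only:)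
    qed
    show "smooth_along (?S \<times> ?S) (\<lambda>(x, y). far_kernel \<Omega> h x y i k)" for i k
      by (rule smooth)
    show "compact_operator_L2 ?M (kernel_op ?M (far_kernel \<Omega> h))"
      by (rule compact_operator_continuous_kernel[OF M S cont])
    show "\<exists>\<rho>\<in>V. solves lam' \<mu>' \<Omega> h \<rho> f"
      if adm: "admissible_lame lam \<mu>" "admissible_lame lam' \<mu>'" and V: "V \<subseteq> L2 ?M"
        and ex: "\<forall>f\<in>W. \<exists>\<rho>\<in>V. solves lam \<mu> \<Omega> h \<rho> f" and f: "f \<in> W"
      for lam \<mu> lam' \<mu>' V W f
    proof -
      obtain \<rho> where \<rho>: "\<rho> \<in> V" "solves lam \<mu> \<Omega> h \<rho> f" using ex f by blast
      \<comment> \<open>The same density serves for both parameter pairs: the equations are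
        equivalent at every boundary point, so no new exceptional null set appears.\<close>
      have "equation_at lam \<mu> \<Omega> h \<rho> f x \<longleftrightarrow> equation_at lam' \<mu>' \<Omega> h \<rho> f x" if "x \<in> space ?M" for x
        unfolding equation_at_def using independent[OF adm, of \<rho> x] \<rho>(1) V that by auto
      then have "AE x in ?M. equation_at lam \<mu> \<Omega> h \<rho> f x \<longrightarrow> equation_at lam' \<mu>' \<Omega> h \<rho> f x"
        by (intro AE_I2) simp
      with \<rho>(2) have "solves lam' \<mu>' \<Omega> h \<rho> f"
        unfolding solves_def by (rule AE_mp)
      with \<rho>(1) show ?thesis by blast
    qed
  qed
qed

end
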